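(* Let $a,b,c>1$ be integers with $\gcd(a,b)>1$, not all three powers of $2$. Suppose the equation $a^x+b^y=c^z$ has two solutions $(x_1,y_1,z_1)$ and $(x_2,y_2,z_2)$ that do not correspond to each other, and that the nine-tuple $(a,b,c,x_1,y_1,z_1,x_2,y_2,z_2)$ is not in any of the infinite families (i), (ii), (iii), (iv). Then $$a=g^{\alpha_g}a_1,\quad b=g^{\beta_g}b_1,\quad c=g^{\gamma_g}c_1$$ for some positive integers $g,\alpha_g,\beta_g,\gamma_g,a_1,b_1,c_1$ with $\gcd(g,a_1b_1c_1)=1$ and $\gcd(a_1,b_1)=1$; one of the two solutions is Type A for $g$ and the other is Type B for $g$; and the equation has no solutions $(x,y,z)$ other than these two (as ordered triples).
   Context: Equation: $a^x+b^y=c^z$ in positive integers $x,y,z$. A solution $(x,y,z)$ for $(a,b,c)$ corresponds to a solution $(X,Y,Z)$ for $(A,B,C)$ if $\{a^x,b^y\}=\{A^X,B^Y\}$. Types: for a prime $p$ dividing all of $a,b,c$, let $p^{\alpha_p}\parallel a$, $p^{\beta_p}\parallel b$, $p^{\gamma_p}\parallel c$. A solution $(x,y,z)$ is Type A for $p$ if $\alpha_p x>\beta_p y=\gamma_p z$, and Type B for $p$ if $\beta_p y>\alpha_p x=\gamma_p z$. For an integer $g>1$ all of whose prime factors divide $a,b,c$, a solution is Type A (resp. Type B) for $g$ if it is Type A (resp. Type B) for every prime dividing $g$. Infinite families (parameters are integers; allowable choices satisfy the constraints with all entries positive integers): (i) $(a,b,c)=(2,2^u(2^{h-1}-1),2^u(2^{h-1}+1))$,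 $(x_1,y_1,z_1)=(u+1,1,1)$, $(x_2,y_2,z_2)=(2u+h+1,2,2)$, $u>0$, $h>1$. (ii) $(a,b,c)=(2\cdot3^t,3,3)$, $(x_1,y_1,z_1)=(1,t,t+1)$, $(x_2,y_2,z_2)=(3,3t,3t+2)$, $t>0$. (iii) $(a,b,c)=(g^j,g^{ju}d,g^{ju}(d+1))$, $(x_1,y_1,z_1)=(u,1,1)$, $(x_2,y_2,z_2)=(ku+\frac wj,k,k)$, $j,u,d>0$, $g>1$ odd, $(d+1)^k-d^k=g^w$, $w>0$, $k>1$. (iv) $(a,b,c)=(2^ig^j,2^{iu-1}g^{ju}d,2^{iu-1}g^{ju}(d+2))$, $(x_1,y_1,z_1)=(u,1,1)$, $(x_2,y_2,z_2)=(ku+\frac wj,k,k)$, $i,j,u>0$, $d>0$ odd, $g>1$ odd, $g^w$ the greatest odd divisor of $(d+2)^k-d^k$, $w>0$, $k>0$ even, $k-v=h-\frac{iw}{j}$ where $2^h\parallel 2d+2$, $2^v\parallel k$. For a family let $F$ be the set of nine-tuples $(a,b,c,x_1,y_1,z_1,x_2,y_2,z_2)$ from allowable parameter choices. A nine-tuple $(a,b,c,x_1,y_1,z_1,x_2,y_2,z_2)$, with $(x_1,y_1,z_1)$, $(x_2,y_2,z_2)$ distinct solutions for $(a,b,c)$, is in the family if some $(A,B,C,X_1,Y_1,Z_1,X_2,Y_2,Z_2)\in F$ has each of its solutions $(X_1,Y_1,Z_1)$, $(X_2,Y_2,Z_2)$ for $(A,B,C)$ corresponding to one of $(x_1,y_1,z_1)$,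 $(x_2,y_2,z_2)$. *)

theory Defs
  imports Complex_Main "HOL-Computational_Algebra.Primes"
begin

type_synonym triple = "nat \<times> nat \<times> nat"

fun is_solution :: "triple \<Rightarrow> triple \<Rightarrow> bool" where
  "is_solution (a, b, c) (x, y, z) \<longleftrightarrow>
     x > 0 \<and> y > 0 \<and> z > 0 \<and> a ^ x + b ^ y = c ^ z"

text \<open>The relation below is meant for solutions \<open>(x, y, z)\<close> for \<open>(a, b, c)\<close> and
  \<open>(X, Y, Z)\<close> for \<open>(A, B, C)\<close>; that they are solutions is required separately.\<close>

fun corresponds :: "triple \<Rightarrow> triple \<Rightarrow> triple \<Rightarrow> triple \<Rightarrow> bool" where
  "corresponds (a, b, c) (x, y, z) (A, B, C) (X, Y, Z) \<longleftrightarrow>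
     {a ^ x, b ^ y} = {A ^ X, B ^ Y}"

fun type_A_prime :: "triple \<Rightarrow> nat \<Rightarrow> triple \<Rightarrow> bool" where
  "type_A_prime (a, b, c) p (x, y, z) \<longleftrightarrow>
     prime p \<and> p dvd a \<and> p dvd b \<and> p dvd c \<and>
     multiplicity p a * x > multiplicity p b * y \<and>
     multiplicity p b * y = multiplicity p c * z"

fun type_B_prime :: "triple \<Rightarrow> nat \<Rightarrow> triple \<Rightarrow> bool" where
  "type_B_prime (a, b, c) p (x, y, z) \<longleftrightarrow>
     prime p \<and> p dvd a \<and> p dvd b \<and> p dvd c \<and>
     multiplicity p b * y > multiplicity p a * x \<and>
     multiplicity p a * x = multiplicity p c * z"

definition type_A :: "triple \<Rightarrow> nat \<Rightarrow> triple \<Rightarrow> bool" where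
  "type_A abc g s \<longleftrightarrow> g > 1 \<and> (\<forall>p. prime p \<and> p dvd g \<longrightarrow> type_A_prime abc p s)"

definition type_B :: "triple \<Rightarrow> nat \<Rightarrow> triple \<Rightarrow> bool" where
  "type_B abc g s \<longleftrightarrow> g > 1 \<and> (\<forall>p. prime p \<and> p dvd g \<longrightarrow> type_B_prime abc p s)"

text \<open>A nine-tuple is grouped as \<open>((a, b, c), (x\<^sub>1, y\<^sub>1, z\<^sub>1), (x\<^sub>2, y\<^sub>2, z\<^sub>2))\<close>. In the third
  and fourth family \<open>j dvd w\<close> says that the entry \<open>x\<^sub>2 = k u + w / j\<close> is an integer.\<close>

type_synonym nine_tuple = "triple \<times> triple \<times> triple"

definition family_i :: "nine_tuple set" where
  "family_i =
     {((2, 2 ^ u * (2 ^ (h - 1) - 1), 2 ^ u * (2 ^ (h - 1) + 1)),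
       (u + 1, 1, 1), (2 * u + h + 1, 2, 2)) | u h.
      u > 0 \<and> h > 1}"

definition family_ii :: "nine_tuple set" where
  "family_ii =
     {((2 * 3 ^ t, 3, 3), (1, t, t + 1), (3, 3 * t, 3 * t + 2)) | t. t > 0}"

definition family_iii :: "nine_tuple set" where
  "family_iii =
     {((g ^ j, g ^ (j * u) * d, g ^ (j * u) * (d + 1)),
       (u, 1, 1), (k * u + w div j, k, k)) | g j u d k w.
      j > 0 \<and> u > 0 \<and> d > 0 \<and> g > 1 \<and> odd g \<and>
      (d + 1) ^ k - d ^ k = g ^ w \<and> w > 0 \<and> k > 1 \<and> j dvd w}"

definition family_iv :: "nine_tuple set" where
  "family_iv =
     {((2 ^ i * g ^ j, 2 ^ (i * u - 1) * g ^ (j * u) * d,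
        2 ^ (i * u - 1) * g ^ (j * u) * (d + 2)),
       (u, 1, 1), (k * u + w div j, k, k)) | i g j u d k w.
      i > 0 \<and> j > 0 \<and> u > 0 \<and> d > 0 \<and> odd d \<and> g > 1 \<and> odd g \<and>
      g ^ w = Max {m. odd m \<and> m dvd (d + 2) ^ k - d ^ k} \<and>
      w > 0 \<and> k > 0 \<and> even k \<and> j dvd w \<and>
      int k - int (multiplicity 2 k) =
        int (multiplicity 2 (2 * d + 2)) - int (i * (w div j))}"

definition in_family :: "nine_tuple set \<Rightarrow> triple \<Rightarrow> triple \<Rightarrow> triple \<Rightarrow> bool" where
  "in_family F abc s1 s2 \<longleftrightarrow>
     is_solution abc s1 \<and> is_solution abc s2 \<and> s1 \<noteq> s2 \<and>
     (\<exists>ABC S1 S2. (ABC, S1, S2) \<in> F \<and>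
        (corresponds ABC S1 abc s1 \<or> corresponds ABC S1 abc s2) \<and>
        (corresponds ABC S2 abc s1 \<or> corresponds ABC S2 abc s2))"

end

theory Submission
  imports Defs "HOL-Number_Theory.Cong"
begin

text \<open>
  Fix a common prime \<open>p\<close> and compare the \<open>p\<close>-adic valuations of \<open>a ^ x\<close>, \<open>b ^ y\<close>, \<open>c ^ z\<close>: the two
  smallest agree. If the same two terms agree in both solutions, two of the three exponents are
  proportional, so after extracting roots \<open>r ^ m - s ^ m\<close> and \<open>r ^ n - s ^ n\<close> (or the two sums)
  are powers of the same number. Lifting the exponent then leaves only the four families. A size
  comparison rules out that \<open>a ^ x\<close> and \<open>b ^ y\<close> are the two terms of smallest valuation in just one of the
  solutions. Hence one solution is of type A and the other of type B at \<open>p\<close>; which one is which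
  depends only on the order of the ratios of the exponents, not on \<open>p\<close>.

  A third solution has to share a proportionality with one of the first two. If all three
  valuations agree for it at some prime, it shares one with both of them, and the two resulting
  family shapes are incompatible; otherwise only the shape of family (i) remains, and there the
  solution of the other type satisfies \<open>1 + 2 ^ l * (2 ^ F - 1) ^ y = (2 ^ F + 1) ^ z\<close> or
  \<open>1 + 2 ^ l * 7 ^ y = 3 ^ z\<close>.
\<close>

section \<open>Lifting the exponent\<close>

text \<open>The comparison is rigid because all primes share one sign. Let the proportional terms be
  \<open>(h * r) ^ m\<close>, \<open>(h * s) ^ m\<close> in one solution and the \<open>n\<close>-th
  powers of the same numbers in the other, with \<open>r\<close>, \<open>s\<close> coprime, and let
  the third base \<open>a\<close> occur with exponents \<open>x\<close> and \<open>y\<close>. If U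
  and V are what remains of \<open>a ^ x\<close> and \<open>a ^ y\<close> after removing
  \<open>h ^ m\<close> and \<open>h ^ n\<close>, then every prime q satisfies n * v_q(U) - m *
  v_q(V) = (n * x - m * y) * v_q(a). A single prime thus decides for all primes of \<open>a\<close>
  on which side the excess lies. For differences this prime divides V but not \<open>r - s\<close>;
  if there is none, an elementary case of Zsigmondy's theorem applies. For sums with
  \<open>r \<noteq> s\<close> the sign comes from size alone. Uniqueness concerns ordered triples,
  whereas the hypotheses work up to correspondence. Next to family (i) a third solution is therefore
  not refuted directly: it is shown to correspond to the second one, and this puts the given pair
  itself into family (i).\<close>

lemma prime_not_dvd_geometric_sum:
  fixes X Y q :: int
  assumes "prime q" "q dvd X - Y" "\<not> q dvd Y" "\<not> q dvd int n"
  shows "\<not> q dvd (\<Sum>i<n. Y ^ (n - Suc i) * X ^ i)"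
proof -
  have XY: "[X = Y] (mod q)" using assms(2) by (simp add: cong_iff_dvd_diff)
  \<comment> \<open>Modulo \<open>q\<close> all \<open>n\<close> summands coincide, because
    \<open>X\<close> and \<open>Y\<close> do.\<close>
  have "[(\<Sum>i<n. Y ^ (n - Suc i) * X ^ i) = (\<Sum>i<n. Y ^ (n - 1))] (mod q)"
  proof (rule cong_sum)
    fix i assume "i \<in> {..<n}"
    then have "Y ^ (n - Suc i) * Y ^ i = Y ^ (n - 1)" by (simp flip: power_add)
    moreover have "[Y ^ (n - Suc i) * X ^ i = Y ^ (n - Suc i) * Y ^ i] (mod q)"
      by (intro cong_mult cong_pow cong_refl XY)
    ultimately show "[Y ^ (n - Suc i) * X ^ i = Y ^ (n - 1)] (mod q)" by simp
  qed
  then have "[(\<Sum>i<n. Y ^ (n - Suc i) * X ^ i) = int n * Y ^ (n - 1)] (mod q)" by simp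
  moreover have "\<not> q dvd int n * Y ^ (n - 1)"
    using assms prime_dvd_mult_iff prime_dvd_power by blast
  ultimately show ?thesis using cong_dvd_iff by blast
qed

text \<open>An expansion modulo \<open>D\<^sup>2\<close> is as much as the exact divisibility of a
  geometric sum by \<open>q\<close> requires. At \<open>i = 0\<close> the exponent
  \<open>i - 1\<close> is truncated, but its coefficient vanishes.\<close>

lemma power_add_second_order:
  fixes Y D :: int
  shows "\<exists>M. (Y + D) ^ i = Y ^ i + int i * D * Y ^ (i - 1) + D\<^sup>2 * M"
proof (induction i)
  case 0
  show ?case by (intro exI[of _ 0]) simp
next
  case (Suc i)
  then obtain M where M: "(Y + D) ^ i = Y ^ i + int i * D * Y ^ (i - 1) + D\<^sup>2 * M" by blast
  have *: "int i * (Y * Y ^ (i - 1)) = int i * Y ^ i" by (cases i) auto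
  have "(Y + D) ^ Suc i = (Y + D) * (Y ^ i + int i * D * Y ^ (i - 1) + D\<^sup>2 * M)" by (simp add: M)
  also have "\<dots> = Y ^ Suc i + D * Y ^ i + D * (int i * (Y * Y ^ (i - 1)))
      + D\<^sup>2 * (int i * Y ^ (i - 1) + (Y + D) * M)"
    by (simp add: algebra_simps power2_eq_square)
  also have "\<dots> = Y ^ Suc i + int (Suc i) * D * Y ^ (Suc i - 1)
      + D\<^sup>2 * (int i * Y ^ (i - 1) + (Y + D) * M)"
    unfolding * by (simp add: algebra_simps)
  finally show ?case by blast
qed

text \<open>The sum is \<open>q * Y ^ (q - 1)\<close> plus a multiple of \<open>q\<^sup>2\<close>.
  For odd \<open>q\<close> the linear terms in \<open>D = X - Y\<close> have total coefficient q *
  (q - 1) / 2, and \<open>D\<close> supplies the second factor \<open>q\<close>. For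
  \<open>q = 2\<close> that coefficient is 1, and the sum X + Y = 2 * Y + (X - Y) has the required
  form because 4 divides \<open>X - Y\<close>.\<close>

lemma geometric_sum_prime_exponent:
  fixes X Y :: int and q :: nat
  assumes q: "prime q" "int q dvd X - Y" "\<not> int q dvd Y" and two: "q = 2 \<Longrightarrow> 4 dvd X - Y"
  shows "int q dvd (\<Sum>i<q. Y ^ (q - Suc i) * X ^ i)"
    and "\<not> (int q)\<^sup>2 dvd (\<Sum>i<q. Y ^ (q - Suc i) * X ^ i)"
proof -
  let ?S = "\<Sum>i<q. Y ^ (q - Suc i) * X ^ i"
  obtain E where E: "?S = int q * Y ^ (q - 1) + (int q)\<^sup>2 * E"
  proof (cases "q = 2")
    case True
    then obtain k where "X = Y + 4 * k" using two by (metis dvdE diff_eq_eq add.commute)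
    then have "?S = int q * Y ^ (q - 1) + (int q)\<^sup>2 * k"
      using True by (simp add: numeral_2_eq_2 lessThan_Suc)
    then show ?thesis using that by blast
  next
    case False
    then have odd: "odd q" using q(1) prime_odd_nat prime_ge_2_nat by (metis le_neq_implies_less)
    define D where "D = X - Y"
    obtain k where k: "D = int q * k" using q(2) D_def by blast
    have "\<forall>i. \<exists>M. X ^ i = Y ^ i + int i * D * Y ^ (i - 1) + D\<^sup>2 * M"
      using power_add_second_order[of Y D] by (simp add: D_def)
    then obtain M where M: "\<And>i. X ^ i = Y ^ i + int i * D * Y ^ (i - 1) + D\<^sup>2 * M i"
      by metis
    have summand: "Y ^ (q - Suc i) * X ^ i
        = Y ^ (q - 1) + int i * (D * Y ^ (q - 2)) + D\<^sup>2 * (Y ^ (q - Suc i) * M i)"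
      if "i \<in> {..<q}" for i
    proof -
      have "Y ^ (q - Suc i) * Y ^ i = Y ^ (q - 1)" using that by (simp flip: power_add)
      moreover have "int i * (Y ^ (q - Suc i) * Y ^ (i - 1)) = int i * Y ^ (q - 2)"
        using that by (cases i) (auto simp flip: power_add simp: numeral_2_eq_2)
      ultimately show ?thesis by (simp add: M algebra_simps)
    qed
    obtain j where j: "q = 2 * j + 1" using odd oddE by blast
    have "2 * (\<Sum>i<q. int i) = int q * (int q - 1)" by (induction q) (auto simp: algebra_simps)
    then have gauss: "(\<Sum>i<q. int i) = int q * int j" using j by simp
    have "?S = int q * Y ^ (q - 1) + (\<Sum>i<q. int i) * (D * Y ^ (q - 2))
        + D\<^sup>2 * (\<Sum>i<q. Y ^ (q - Suc i) * M i)"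
      by (subst sum.cong[OF refl summand]) (auto simp: sum.distrib sum_distrib_left sum_distrib_right)
    then have "?S = int q * Y ^ (q - 1)
        + (int q)\<^sup>2 * (int j * k * Y ^ (q - 2) + k\<^sup>2 * (\<Sum>i<q. Y ^ (q - Suc i) * M i))"
      unfolding gauss k by (simp add: algebra_simps power2_eq_square)
    then show ?thesis using that by blast
  qed
  show "int q dvd ?S" unfolding E by (simp add: power2_eq_square)
  have "\<not> (int q)\<^sup>2 dvd int q * Y ^ (q - 1)"
  proof
    assume "(int q)\<^sup>2 dvd int q * Y ^ (q - 1)"
    then have "int q dvd Y ^ (q - 1)"
      using q(1) by (simp add: power2_eq_square prime_gt_0_nat)
    then show False using q prime_dvd_power prime_int_nat_transfer by (metis prime_nat_int_transfer)
  qed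
  then show "\<not> (int q)\<^sup>2 dvd ?S" unfolding E by (simp add: dvd_add_left_iff)
qed

text \<open>Induction strips one factor \<open>q\<close> at a time from \<open>n\<close>: the
  cofactor of \<open>X ^ m - Y ^ m\<close> in \<open>X ^ (m * q) - Y ^ (m * q)\<close> contains
  \<open>q\<close> exactly once, and for \<open>n\<close> prime to \<open>q\<close> the cofactor of
  \<open>X - Y\<close> does not contain it at all. The condition \<open>X ^ n \<noteq> Y ^ n\<close>
  avoids the multiplicity of 0, which is 0 by convention.\<close>

theorem lifting_the_exponent:
  fixes X Y :: int and q :: nat
  assumes q: "prime q" "int q dvd X - Y" "\<not> int q dvd Y"
    and two: "q = 2 \<Longrightarrow> 4 dvd X - Y \<or> odd n" and n: "n > 0" and ne: "X ^ n \<noteq> Y ^ n"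
  shows "multiplicity (int q) (X ^ n - Y ^ n) = multiplicity (int q) (X - Y) + multiplicity q n"
  using two n ne
proof (induction n rule: less_induct)
  case (less n)
  have pq: "prime (int q)" using q(1) by simp
  show ?case
  proof (cases "q dvd n")
    case False
    let ?S = "\<Sum>i<n. Y ^ (n - Suc i) * X ^ i"
    have nd: "\<not> int q dvd ?S"
      using prime_not_dvd_geometric_sum[OF pq q(2,3)] False by simp
    have eq: "X ^ n - Y ^ n = (X - Y) * ?S" by (rule power_diff_sumr2)
    have "multiplicity (int q) ((X - Y) * ?S) = multiplicity (int q) (X - Y) + multiplicity (int q) ?S"
      using less.prems eq pq by (intro prime_elem_multiplicity_mult_distrib) auto
    then show ?thesis using nd False eq by (simp add: not_dvd_imp_multiplicity_0)
  next
    case True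
    then obtain m where m: "n = m * q" by (metis dvdE mult.commute)
    have m0: "m > 0" "m < n" using less.prems(2) m prime_gt_1_nat[OF q(1)] by auto
    let ?X = "X ^ m" and ?Y = "Y ^ m"
    let ?S = "\<Sum>i<q. ?Y ^ (q - Suc i) * ?X ^ i"
    have dv: "X - Y dvd ?X - ?Y" by (simp add: power_diff_sumr2)
    have ne': "?X \<noteq> ?Y" using less.prems(3) m by (metis power_mult)
    have two': "4 dvd X - Y" if "q = 2" using less.prems(1) that m by auto
    have IH: "multiplicity (int q) (?X - ?Y) = multiplicity (int q) (X - Y) + multiplicity q m"
      using less.IH[OF m0(2) _ m0(1) ne'] two' by blast
    have "int q dvd ?X - ?Y" using dv q(2) dvd_trans by blast
    moreover have "\<not> int q dvd ?Y" using q(3) pq prime_dvd_power by blast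
    moreover have "4 dvd ?X - ?Y" if "q = 2" using two'[OF that] dv dvd_trans by blast
    ultimately have S: "int q dvd ?S" "\<not> (int q)\<^sup>2 dvd ?S"
      using geometric_sum_prime_exponent[OF q(1), of ?X ?Y] by blast+
    have eq: "X ^ n - Y ^ n = (?X - ?Y) * ?S"
      unfolding m power_mult by (rule power_diff_sumr2)
    have S0: "?S \<noteq> 0" using S(2) by auto
    have mS: "multiplicity (int q) ?S = 1"
      using S by (intro multiplicity_eqI) (auto simp: power2_eq_square)
    have "multiplicity (int q) ((?X - ?Y) * ?S) = multiplicity (int q) (?X - ?Y) + 1"
      using S0 ne' pq mS by (subst prime_elem_multiplicity_mult_distrib) auto
    moreover have "multiplicity q n = multiplicity q m + 1"
      using q(1) m0 m prime_elem_multiplicity_mult_distrib[of q m q]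
      by (simp add: prime_gt_0_nat)
    ultimately show ?thesis using IH eq by simp
  qed
qed

lemma multiplicity_int: "multiplicity (int q) (int k) = multiplicity q k"
proof -
  have "int q ^ n dvd int k \<longleftrightarrow> q ^ n dvd k" for n by (simp flip: of_nat_power)
  then show ?thesis by (simp add: multiplicity_def)
qed

text \<open>Truncated subtraction does no harm: for \<open>u < v\<close> both sides are 0.\<close>

lemma square_diff_nat: "u\<^sup>2 - v\<^sup>2 = (u + v) * (u - v)" for u v :: nat
proof (cases "v \<le> u")
  case True
  then obtain w where "u = v + w" using le_Suc_ex by blast
  then show ?thesis by (simp add: power2_eq_square algebra_simps)
next
  case False
  then show ?thesis by simp
qed

lemma diff_dvd_power_diff_nat:
  fixes r s :: nat
  shows "r - s dvd r ^ n - s ^ n"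
proof (cases "s \<le> r")
  case True
  then have e: "int r - int s = int (r - s)" "int r ^ n - int s ^ n = int (r ^ n - s ^ n)"
    using power_mono[OF True] by (simp_all only: of_nat_diff of_nat_power zero_le)
  have "int r - int s dvd int r ^ n - int s ^ n" by (simp add: power_diff_sumr2)
  then show ?thesis by (simp only: e int_dvd_int_iff)
next
  case False
  then show ?thesis using power_mono[of r s n] by simp
qed

lemma lifting_the_exponent_nat:
  fixes r s q :: nat
  assumes q: "prime q" "q dvd r - s" "\<not> q dvd s" and rs: "s < r" and n: "n > 0"
    and two: "q = 2 \<Longrightarrow> 4 dvd r - s \<or> odd n"
  shows "multiplicity q (r ^ n - s ^ n) = multiplicity q (r - s) + multiplicity q n"
proof -
  have lt: "s ^ n < r ^ n" using rs n by (simp add: power_strict_mono)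
  have e: "int r - int s = int (r - s)" "int r ^ n - int s ^ n = int (r ^ n - s ^ n)"
    using less_imp_le[OF rs] less_imp_le[OF lt] by (simp_all only: of_nat_diff of_nat_power)
  have "multiplicity (int q) (int r ^ n - int s ^ n) = multiplicity (int q) (int r - int s) + multiplicity q n"
  proof (rule lifting_the_exponent)
    show "int q dvd int r - int s" using q(2) by (simp only: e int_dvd_int_iff)
    have "4 dvd int r - int s" if "4 dvd r - s"
      unfolding e using that by (metis int_dvd_int_iff of_nat_numeral)
    then show "4 dvd int r - int s \<or> odd n" if "q = 2"
      using two[OF that] by blast
    show "int r ^ n \<noteq> int s ^ n" using lt by (simp flip: of_nat_power)
  qed (use q n in auto)
  then show ?thesis by (simp only: e multiplicity_int)
qed

text \<open>The integer version for \<open>r\<close> and \<open>- s\<close>; an odd exponent turns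
  the difference into the sum.\<close>

lemma lifting_the_exponent_plus:
  fixes r s q :: nat
  assumes q: "prime q" "q dvd r + s" "\<not> q dvd s" and n: "odd n" and r: "r > 0"
  shows "multiplicity q (r ^ n + s ^ n) = multiplicity q (r + s) + multiplicity q n"
proof -
  have e: "int r - (- int s) = int (r + s)" "int r ^ n - (- int s) ^ n = int (r ^ n + s ^ n)"
    using n by auto
  have "multiplicity (int q) (int r ^ n - (- int s) ^ n)
      = multiplicity (int q) (int r - (- int s)) + multiplicity q n"
  proof (rule lifting_the_exponent)
    show "int r ^ n \<noteq> (- int s) ^ n"
    proof
      assume "int r ^ n = (- int s) ^ n"
      then have "int (r ^ n + s ^ n) = 0" using e(2) by simp
      then have "r ^ n + s ^ n = 0" by (simp only: of_nat_eq_0_iff)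
      then show False using r by simp
    qed
    show "n > 0" using n odd_pos by blast
    show "int q dvd int r - (- int s)" using q(2) by (simp only: e int_dvd_int_iff)
  qed (use q n in auto)
  then show ?thesis by (simp only: e multiplicity_int)
qed

section \<open>Power differences and power sums without new prime divisors\<close>

lemma eq_prime_power_of_prime_divisors:
  fixes N p :: nat
  assumes "prime p" "N > 0" "\<And>q. prime q \<Longrightarrow> q dvd N \<Longrightarrow> q = p"
  shows "\<exists>f. N = p ^ f"
proof -
  obtain y where y: "N = p ^ multiplicity p N * y" "\<not> p dvd y"
    using multiplicity_decompose'[of N p] assms(1,2) not_prime_unit by blast
  have "y = 1"
  proof (rule ccontr)
    assume "y \<noteq> 1"
    then obtain q where "prime q" "q dvd y" using prime_factor_nat by blast
    moreover have "q dvd N" using calculation(2) by (subst y(1)) simp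
    ultimately have "q = p" by (intro assms(3))
    with \<open>q dvd y\<close> have "p dvd y" by simp
    then show False using y(2) by simp
  qed
  then show ?thesis using y by auto
qed

text \<open>Lifting the exponent shows that each prime of the power difference occurs in it as often
  as in \<open>n * (r - s)\<close>. The resulting bound is linear in \<open>n\<close> and collides
  with exponential growth. \<open>two\<close> is the side condition of lifting at 2.\<close>

lemma power_diff_dvd_of_prime_divisors:
  fixes r s n :: nat
  assumes rs: "s < r" "coprime r s" and n: "n > 0"
    and pr: "\<And>q. prime q \<Longrightarrow> q dvd r ^ n - s ^ n \<Longrightarrow> q dvd r - s"
    and two: "odd n \<or> odd (r - s) \<or> 4 dvd r - s"
  shows "r ^ n - s ^ n dvd n * (r - s)"
proof (rule multiplicity_le_imp_dvd)
  have lt: "s ^ n < r ^ n" using rs n by (simp add: power_strict_mono)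
  then show "r ^ n - s ^ n \<noteq> 0" by simp
  fix q :: nat assume q: "prime q"
  show "multiplicity q (r ^ n - s ^ n) \<le> multiplicity q (n * (r - s))"
  proof (cases "q dvd r ^ n - s ^ n")
    case True
    then have d: "q dvd r - s" using pr q by blast
    have nd: "\<not> q dvd s"
    proof
      assume "q dvd s"
      then have "q dvd r" using d rs(1) by (metis dvd_diffD less_imp_le)
      then show False using \<open>q dvd s\<close> rs(2) q by (meson coprime_common_divisor not_prime_unit)
    qed
    have "multiplicity q (r ^ n - s ^ n) = multiplicity q (r - s) + multiplicity q n"
      by (rule lifting_the_exponent_nat[OF q d nd rs(1) n]) (use two d in blast)
    moreover have "multiplicity q (n * (r - s)) = multiplicity q n + multiplicity q (r - s)"
      using q n rs(1) by (intro prime_elem_multiplicity_mult_distrib) auto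
    ultimately show ?thesis by simp
  qed (simp add: not_dvd_imp_multiplicity_0)
qed

lemma power_diff_ge:
  fixes r s n :: nat
  assumes "s < r" "s > 0" "n > 1"
  shows "(r - s) * r ^ (n - 1) < r ^ n - s ^ n"
proof -
  have "s ^ (n - 1) < r ^ (n - 1)" using assms by (simp add: power_strict_mono)
  then have "s * s ^ (n - 1) < s * r ^ (n - 1)" using assms by simp
  moreover have "s * s ^ (n - 1) = s ^ n" "r * r ^ (n - 1) = r ^ n"
    using assms by (auto simp flip: power_Suc)
  moreover have "s * r ^ (n - 1) \<le> r * r ^ (n - 1)" using assms by simp
  moreover have "(r - s) * r ^ (n - 1) = r * r ^ (n - 1) - s * r ^ (n - 1)"
    by (rule diff_mult_distrib)
  ultimately show ?thesis by linarith
qed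

text \<open>An elementary case of Zsigmondy's theorem. For odd \<open>n\<close> the bound
  \<open>n * (r - s)\<close> contradicts growth at once. For even \<open>n\<close> a prime of
  \<open>r + s\<close> divides \<open>r\<^sup>2 - s\<^sup>2\<close>, hence \<open>r - s\<close>,
  hence both \<open>2 * r\<close> and \<open>2 * s\<close>, so it is 2; this makes
  \<open>r + s\<close> a power of 2 and \<open>r\<close>, \<open>s\<close> odd.\<close>

lemma prime_divisors_of_power_diff:
  fixes r s n :: nat
  assumes rs: "s < r" "s > 0" "coprime r s" and n: "n > 1"
    and pr: "\<And>q. prime q \<Longrightarrow> q dvd r ^ n - s ^ n \<Longrightarrow> q dvd r - s"
  shows "n = 2 \<and> odd r \<and> odd s \<and> (\<exists>f. r + s = 2 ^ f)"
proof -
  have r2: "r \<ge> 2" using rs by simp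
  have pw: "n \<le> r ^ (n - 1)" for n
  proof -
    have "n - 1 < 2 ^ (n - 1)" by (rule less_exp)
    also have "(2::nat) ^ (n - 1) \<le> r ^ (n - 1)" using r2 by (simp add: power_mono)
    finally show ?thesis by simp
  qed
  have even: "even n"
  proof (rule ccontr)
    assume o: "odd n"
    have "r ^ n - s ^ n dvd n * (r - s)"
      using power_diff_dvd_of_prime_divisors[OF rs(1,3) _ pr] n o by auto
    then have "r ^ n - s ^ n \<le> n * (r - s)" using n rs by (intro dvd_imp_le) auto
    moreover have "n * (r - s) \<le> (r - s) * r ^ (n - 1)" using pw[of n] by simp
    ultimately show False using power_diff_ge[OF rs(1,2) n] by linarith
  qed
  then obtain k where k: "n = 2 * k" "k > 0" using n by auto
  have sq: "r\<^sup>2 - s\<^sup>2 = (r - s) * (r + s)"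
    by (simp add: square_diff_nat)
  have dv: "r\<^sup>2 - s\<^sup>2 dvd r ^ n - s ^ n"
    unfolding k(1) power_mult by (rule diff_dvd_power_diff_nat)
  have q2: "q = 2 \<and> even (r - s)" if "prime q" "q dvd r + s" for q
  proof -
    have "q dvd r\<^sup>2 - s\<^sup>2" unfolding sq using that(2) by simp
    then have d: "q dvd r - s" using pr[OF that(1)] dv dvd_trans by blast
    then have "q dvd (r + s) + (r - s)" "q dvd (r + s) - (r - s)"
      using that(2) by (blast intro: dvd_add dvd_diff_nat)+
    then have "q dvd 2 * r" "q dvd 2 * s" using rs(1) by (simp_all add: mult_2)
    then have "q dvd 2"
      using that(1) rs(3) by (metis coprime_common_divisor not_prime_unit prime_dvd_multD)
    then have "q = 2" using that(1) primes_dvd_imp_eq two_is_prime_nat by blast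
    then show ?thesis using d by simp
  qed
  obtain f where f: "r + s = 2 ^ f"
    using eq_prime_power_of_prime_divisors[of 2 "r + s"] q2 rs by auto
  obtain q where "prime q" "q dvd r + s" using rs prime_factor_nat[of "r + s"] by auto
  then have ev: "even (r - s)" using q2 by blast
  have same: "even r \<longleftrightarrow> even s" using ev rs(1) by (simp add: even_diff_nat)
  have "\<not> (even r \<and> even s)"
    using rs(3) coprime_common_divisor[of r s 2] by auto
  then have par: "odd r" "odd s" using same by auto
  \<comment> \<open>The growth argument is repeated for \<open>r\<^sup>2\<close> and
    \<open>s\<^sup>2\<close>: their difference is divisible by 4, so lifting at 2 works for every
    \<open>k\<close>.\<close>
  have "k = 1"
  proof (rule ccontr)
    assume "k \<noteq> 1"
    then have k1: "k > 1" using k by simp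
    have lt: "s\<^sup>2 < r\<^sup>2" using rs by (simp add: power_strict_mono)
    have "even (r + s)" using par by simp
    then have "2 * 2 dvd (r - s) * (r + s)" using ev by (intro mult_dvd_mono) auto
    then have four: "4 dvd r\<^sup>2 - s\<^sup>2" using sq by simp
    have "(r\<^sup>2) ^ k - (s\<^sup>2) ^ k dvd k * (r\<^sup>2 - s\<^sup>2)"
    proof (rule power_diff_dvd_of_prime_divisors[OF lt])
      show "coprime (r\<^sup>2) (s\<^sup>2)" using rs by simp
      show "q dvd r\<^sup>2 - s\<^sup>2" if "prime q" "q dvd (r\<^sup>2) ^ k - (s\<^sup>2) ^ k" for q
        using pr[OF that(1)] that(2) sq by (simp add: k power_mult)
    qed (use four k in auto)
    then have "(r\<^sup>2) ^ k - (s\<^sup>2) ^ k \<le> k * (r\<^sup>2 - s\<^sup>2)" using k lt by (intro dvd_imp_le) auto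
    moreover have "k * (r\<^sup>2 - s\<^sup>2) \<le> (r\<^sup>2 - s\<^sup>2) * (r\<^sup>2) ^ (k - 1)"
    proof -
      have "k \<le> r ^ (k - 1)" by (rule pw)
      also have "\<dots> \<le> (r\<^sup>2) ^ (k - 1)" using r2 by (intro power_mono) (auto simp: power2_eq_square)
      finally show ?thesis by simp
    qed
    moreover have "(r\<^sup>2 - s\<^sup>2) * (r\<^sup>2) ^ (k - 1) < (r\<^sup>2) ^ k - (s\<^sup>2) ^ k"
      using power_diff_ge[OF lt _ k1] rs by simp
    ultimately show False by linarith
  qed
  then show ?thesis using k par f by auto
qed

text \<open>As for differences, the sum divides \<open>n * (r + s)\<close>, so
  \<open>r ^ (n - 1) < 2 * n\<close>. The survivor is 2^3 + 1^3 = 9, whose only prime is already 2 +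
  1.\<close>

lemma prime_divisors_of_power_sum:
  fixes r s n :: nat
  assumes rs: "s < r" "s > 0" "coprime r s" and n: "n > 1" "odd n"
    and pr: "\<And>q. prime q \<Longrightarrow> q dvd r ^ n + s ^ n \<Longrightarrow> q dvd r + s"
  shows "n = 3 \<and> r = 2 \<and> s = 1"
proof -
  have "r ^ n + s ^ n dvd n * (r + s)"
  proof (rule multiplicity_le_imp_dvd)
    show "r ^ n + s ^ n \<noteq> 0" using rs by simp
    fix q :: nat assume q: "prime q"
    show "multiplicity q (r ^ n + s ^ n) \<le> multiplicity q (n * (r + s))"
    proof (cases "q dvd r ^ n + s ^ n")
      case True
      then have d: "q dvd r + s" using pr q by blast
      have nd: "\<not> q dvd s"
        using d rs(3) q by (metis coprime_common_divisor dvd_add_left_iff not_prime_unit)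
      have "multiplicity q (r ^ n + s ^ n) = multiplicity q (r + s) + multiplicity q n"
        using lifting_the_exponent_plus[OF q d nd n(2)] rs by auto
      moreover have "multiplicity q (n * (r + s)) = multiplicity q n + multiplicity q (r + s)"
        using q n rs(1) by (intro prime_elem_multiplicity_mult_distrib) auto
      ultimately show ?thesis by simp
    qed (simp add: not_dvd_imp_multiplicity_0)
  qed
  then have le: "r ^ n + s ^ n \<le> n * (r + s)" using n rs by (intro dvd_imp_le) auto
  have "r * r ^ (n - 1) = r ^ n" using n by (simp flip: power_Suc)
  moreover have "n * (r + s) < r * (2 * n)" using rs n by (simp add: algebra_simps)
  ultimately have "r * r ^ (n - 1) < r * (2 * n)" using le by linarith
  then have lt: "r ^ (n - 1) < 2 * n" by simp
  have r2: "r \<ge> 2" using rs by simp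
  have n3: "n = 3"
  proof (rule ccontr)
    assume "n \<noteq> 3"
    then have n4: "n \<ge> 4" using n by presburger
    then have "2 * n \<le> 2 ^ (n - 1)"
    proof (induction n rule: nat_induct_at_least)
      case (Suc n)
      then have "(2::nat) ^ (Suc n - 1) = 2 * 2 ^ (n - 1)" by (simp flip: power_Suc)
      then show ?case using Suc(1) Suc.IH by (simp del: power_Suc)
    qed simp
    also have "(2::nat) ^ (n - 1) \<le> r ^ (n - 1)" using r2 by (simp add: power_mono)
    finally show False using lt by simp
  qed
  then have "r\<^sup>2 < 6" using lt by simp
  have "r = 2"
  proof (rule ccontr)
    assume "r \<noteq> 2"
    then have "3 * 3 \<le> r * r" using r2 by (intro mult_mono) auto
    then show False using \<open>r\<^sup>2 < 6\<close> by (simp add: power2_eq_square)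
  qed
  then show ?thesis using n3 rs by auto
qed

section \<open>Differences and sums of powers that are powers of one number\<close>

text \<open>Bezout in the exponents, in the subtraction-free form
  \<open>m * u = n * v + gcd m n\<close>; the surplus factor \<open>s ^ (n * v)\<close> is prime to
  \<open>q\<close> and cancels.\<close>

lemma cong_power_gcd:
  fixes r s m n q :: nat
  assumes q: "prime q" "\<not> q dvd s" and m: "m > 0"
    and c: "[r ^ m = s ^ m] (mod q)" "[r ^ n = s ^ n] (mod q)"
  shows "[r ^ gcd m n = s ^ gcd m n] (mod q)"
proof -
  obtain u v where uv: "m * u = n * v + gcd m n" using bezout_nat[of m n] m by auto
  have "[r ^ (n * v) = s ^ (n * v)] (mod q)" "[r ^ (m * u) = s ^ (m * u)] (mod q)"
    unfolding power_mult using c by (simp_all add: cong_pow)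
  then have "[s ^ (n * v) * r ^ gcd m n = s ^ (n * v) * s ^ gcd m n] (mod q)"
    unfolding uv power_add by (metis cong_def mod_mult_left_eq)
  moreover have "coprime (s ^ (n * v)) q"
    using q by (metis coprime_commute coprime_power_right_iff prime_imp_coprime)
  ultimately show ?thesis by (simp add: cong_mult_lcancel_nat)
qed

lemma dvd_power_diff_iff_cong:
  fixes r s q :: nat
  assumes "s \<le> r"
  shows "q dvd r ^ n - s ^ n \<longleftrightarrow> [r ^ n = s ^ n] (mod q)"
  using assms by (metis cong_altdef_nat power_mono zero_le)

lemma prime_dvd_power_diff_gcd:
  fixes r s m n q :: nat
  assumes q: "prime q" "\<not> q dvd s" and m: "m > 0" and "s \<le> r"
    and "q dvd r ^ m - s ^ m" "q dvd r ^ n - s ^ n"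
  shows "q dvd r ^ gcd m n - s ^ gcd m n"
  using cong_power_gcd[OF q m] assms by (simp add: dvd_power_diff_iff_cong)

lemma multiplicity_nat_less: "prime q \<Longrightarrow> n > 0 \<Longrightarrow> multiplicity q n < n" for q n :: nat
proof -
  assume q: "prime q" and n: "n > 0"
  have "multiplicity q n < q ^ multiplicity q n"
    using prime_gt_1_nat[OF q] by (simp add: power_gt_expt)
  also have "\<dots> \<le> n" using n by (intro dvd_imp_le multiplicity_dvd) auto
  finally show ?thesis .
qed

lemma multiplicity_mult_power:
  fixes q h u :: nat
  assumes "prime q" "h > 0" "u > 0"
  shows "multiplicity q (h ^ k * u) = k * multiplicity q h + multiplicity q u"
  using assms by (simp add: prime_elem_multiplicity_mult_distrib prime_elem_multiplicity_power_distrib)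

text \<open>Lifting at 2 is applied to the squares, whose difference is divisible by 4. The added 1
  accounts for the factor 2 taken out of \<open>n\<close>.\<close>

lemma multiplicity_two_power_diff:
  fixes r s n :: nat
  assumes rs: "s < r" "odd r" "odd s" and n: "even n" "n > 0"
  shows "multiplicity 2 (r ^ n - s ^ n) + 1 = multiplicity 2 (r - s) + multiplicity 2 (r + s) + multiplicity 2 n"
proof -
  obtain k where k: "n = 2 * k" "k > 0" using n by auto
  have sq: "r\<^sup>2 - s\<^sup>2 = (r - s) * (r + s)"
    by (simp add: square_diff_nat)
  have "2 * 2 dvd (r - s) * (r + s)" using rs by (intro mult_dvd_mono) auto
  then have four: "4 dvd r\<^sup>2 - s\<^sup>2" using sq by simp
  have "multiplicity 2 ((r\<^sup>2) ^ k - (s\<^sup>2) ^ k) = multiplicity 2 (r\<^sup>2 - s\<^sup>2) + multiplicity 2 k"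
    using four rs k by (intro lifting_the_exponent_nat) (auto simp: power_strict_mono)
  moreover have "multiplicity 2 ((r - s) * (r + s)) = multiplicity 2 (r - s) + multiplicity 2 (r + s)"
    using rs by (intro prime_elem_multiplicity_mult_distrib) auto
  moreover have "multiplicity 2 n = multiplicity 2 k + 1"
    using k prime_elem_multiplicity_mult_distrib[of 2 2 k] by simp
  ultimately show ?thesis using sq by (simp add: k power_mult)
qed

text \<open>After division by \<open>h = gcd r0 s0\<close> the outcomes are \<open>r - s = 2\<close>
  with \<open>r + s\<close> a power of 2, \<open>r - s = 1\<close>, and \<open>r - s = 2\<close>
  with an odd prime in \<open>a\<close>. In the last two cases some prime of \<open>V\<close> does
  not divide \<open>r - s\<close>; it makes \<open>V\<close> the richer part at every prime of
  \<open>a\<close>. Lifting the exponent, however, lets \<open>V\<close> exceed \<open>r - s\<close>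
  only by the small valuation of \<open>n\<close>, except at 2, so \<open>r - s\<close> has hardly
  room for prime factors.\<close>

lemma power_difference_pair:
  fixes r0 s0 a x y m n :: nat
  assumes mn: "coprime m n" "m > 0" "m < n" and a: "a > 1" and s0: "s0 > 0"
    and e1: "r0 ^ m = s0 ^ m + a ^ x" and e2: "r0 ^ n = s0 ^ n + a ^ y"
    and gcd: "gcd r0 s0 > 1"
  shows "m = 1 \<and>
    ((\<exists>F e. F > 0 \<and> e > 0 \<and> n = 2 \<and> r0 = 2 ^ e * (2 ^ F + 1) \<and> s0 = 2 ^ e * (2 ^ F - 1)) \<or>
     (\<exists>s. s > 0 \<and> r0 = a ^ x * (s + 1) \<and> s0 = a ^ x * s \<and> n * x < y \<and>
        (s + 1) ^ n = s ^ n + a ^ (y - n * x) \<and> odd a) \<or>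
     (\<exists>h s. odd s \<and> 2 * h = a ^ x \<and> r0 = h * (s + 2) \<and> s0 = h * s \<and> n * x < y \<and>
        (s + 2) ^ n = s ^ n + 2 ^ n * a ^ (y - n * x) \<and> even n \<and>
        (\<exists>q. prime q \<and> odd q \<and> q dvd a)))"
proof -
  define h where "h = gcd r0 s0"
  have h1: "h > 1" using gcd h_def by simp
  obtain r s where rs: "r0 = h * r" "s0 = h * s" "coprime r s"
    using gcd_coprime_exists[of r0 s0] h1 h_def by (metis mult.commute less_nat_zero_code)
  have s: "s > 0" using s0 rs by simp
  have "s0 ^ m < r0 ^ m" using e1 a by simp
  then have "s0 < r0" using power_less_imp_less_base by blast
  then have r: "s < r" using rs by simp
  define U V where "U = r ^ m - s ^ m" and "V = r ^ n - s ^ n"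
  have n: "n > 1" using mn by simp
  have lt: "s ^ m < r ^ m" "s ^ n < r ^ n" using r mn n by (simp_all add: power_strict_mono)
  have UV: "U > 0" "V > 0" using lt by (simp_all add: U_def V_def)
  have ex: "a ^ x = h ^ m * U"
    using e1 lt by (simp add: U_def rs power_mult_distrib diff_mult_distrib2)
  have ey: "a ^ y = h ^ n * V"
    using e2 lt by (simp add: V_def rs power_mult_distrib diff_mult_distrib2)
  have vU: "x * multiplicity q a = m * multiplicity q h + multiplicity q U" if "prime q" for q
    using that a h1 UV multiplicity_mult_power[of q h U m]
    by (simp flip: ex add: prime_elem_multiplicity_power_distrib)
  have vV: "y * multiplicity q a = n * multiplicity q h + multiplicity q V" if "prime q" for q
    using that a h1 UV multiplicity_mult_power[of q h V n]
    by (simp flip: ey add: prime_elem_multiplicity_power_distrib)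
  have nd: "\<not> q dvd s" if "prime q" "q dvd r ^ k - s ^ k" "k > 0" for q k
  proof
    assume "q dvd s"
    then have "q dvd s ^ k" using that(3) by (simp add: dvd_power_same dvd_power dvd_trans)
    then have "q dvd r ^ k" using that(2) r by (metis dvd_diffD less_imp_le power_mono zero_le)
    then show False using \<open>q dvd s\<close> rs(3) that(1) prime_dvd_power by (meson coprime_common_divisor not_prime_unit)
  qed
  have common: "q dvd r - s" if "prime q" "q dvd U" "q dvd V" for q
    using prime_dvd_power_diff_gcd[of q s m r n] nd[of q m] that mn r by (simp add: U_def V_def coprime_imp_gcd_eq_1)
  have rsU: "r - s dvd U" and rsV: "r - s dvd V"
    unfolding U_def V_def by (rule diff_dvd_power_diff_nat)+
  have dvda: "q dvd a" if "prime q" "q dvd h * U * V" for q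
  proof -
    have "q dvd a ^ x \<or> q dvd a ^ y"
      using that mn n unfolding ex ey by (auto simp: prime_dvd_mult_iff prime_dvd_power_iff)
    then show ?thesis using that(1) prime_dvd_power by blast
  qed
  show ?thesis
  proof (cases "\<forall>q. prime q \<longrightarrow> q dvd V \<longrightarrow> q dvd r - s")
    case True
    then have n2: "n = 2" and par: "odd r" "odd s" and "\<exists>f. r + s = 2 ^ f"
      using prime_divisors_of_power_diff[OF r s rs(3) n] by (auto simp: V_def)
    then obtain f where f: "r + s = 2 ^ f" by blast
    have m1: "m = 1" using mn n2 by simp
    have U: "U = r - s" by (simp add: U_def m1)
    have ev: "even (r - s)" using par by simp
    have r3: "r \<ge> 3" using par r s by presburger
    have f2: "f \<ge> 2"
    proof (rule ccontr)
      assume "\<not> f \<ge> 2"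
      then have "f = 0 \<or> f = 1" by linarith
      then show False using f r3 s by auto
    qed
    have V: "V = (r - s) * 2 ^ f"
      using r by (simp add: V_def n2 power2_eq_square diff_mult_distrib algebra_simps flip: f)
    have mV: "multiplicity q V = multiplicity q (r - s) + multiplicity q (2 ^ f)" if "prime q" for q
      unfolding V using that r by (intro prime_elem_multiplicity_mult_distrib) auto
    have "4 dvd r + s" using f2 f by (metis le_imp_power_dvd power2_eq_square numeral_Bit0_eq_double mult_2)
    then have n4: "\<not> 4 dvd r - s" using par r by presburger
    have m2: "multiplicity 2 (r - s) = 1"
      using ev n4 by (intro multiplicity_eqI) auto
    have "y * multiplicity 2 a = 2 * (x * multiplicity 2 a) + (f - 1)"
      using vU[of 2] vV[of 2] mV[of 2] f2 m2 by (simp add: m1 n2 U)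
    then have "2 * (x * multiplicity 2 a) < y * multiplicity 2 a" using f2 by linarith
    then have yx: "2 * x < y" by (metis mult.assoc mult_less_cancel2)
    \<comment> \<open>At 2 the factor \<open>r + s\<close> of \<open>V\<close> contributes
      \<open>f \<ge> 2\<close> and \<open>r - s\<close> only 1, which gave \<open>2 * x < y\<close>.
      At an odd prime \<open>r + s\<close> contributes nothing, and the same comparison would give
      \<open>y \<le> 2 * x\<close>.\<close>
    have only2: "q = 2" if "prime q" "q dvd a" for q
    proof (rule ccontr)
      assume "q \<noteq> 2"
      then have "\<not> q dvd 2 ^ f" using that(1) by (metis prime_dvd_power primes_dvd_imp_eq two_is_prime_nat)
      then have "multiplicity q ((2::nat) ^ f) = 0" by (simp add: not_dvd_imp_multiplicity_0)
      then have "y * multiplicity q a \<le> 2 * (x * multiplicity q a)"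
        using vU[OF that(1)] vV[OF that(1)] mV[OF that(1)] by (simp add: m1 n2 U)
      then have "multiplicity q a = 0" using yx by (metis mult.assoc mult_le_cancel2 not_le neq0_conv)
      moreover have "multiplicity q a > 0"
        using that a by (simp add: prime_multiplicity_gt_zero_iff)
      ultimately show False by simp
    qed
    have two2: "q = 2" if "prime q" "q dvd h * U * V" for q
      using only2[OF that(1)] dvda that by blast
    obtain e where e: "h = 2 ^ e"
      using eq_prime_power_of_prime_divisors[of 2 h] two2 h1 by auto
    have e0: "e > 0" using h1 e by (cases e) auto
    obtain i where i: "r - s = 2 ^ i"
      using eq_prime_power_of_prime_divisors[of 2 "r - s"] two2 r U by auto
    have "i = 1" using m2 i by (simp add: multiplicity_same_power)
    then have rs2: "r = s + 2" using i r by simp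
    define F where "F = f - 1"
    have F: "f = F + 1" "F > 0" using f2 F_def by auto
    have "r = 2 ^ F + 1" "s = 2 ^ F - 1" using f rs2 F by auto
    then show ?thesis using m1 n2 F e e0 rs by blast
  next
    case False
    then obtain q where q: "prime q" "q dvd V" "\<not> q dvd r - s" by blast
    have qU: "\<not> q dvd U" using common q by blast
    have qa: "q dvd a" using dvda q by simp
    have qh: "q dvd h"
    proof -
      have x0: "x > 0"
      proof (rule ccontr)
        assume "\<not> x > 0"
        then have "h ^ m * U = 1" using ex by simp
        then show False using h1 mn by simp
      qed
      have "q dvd h ^ m * U" using qa x0 unfolding ex[symmetric] by (simp add: dvd_power dvd_trans)
      then show ?thesis using q(1) qU by (auto simp: prime_dvd_mult_iff prime_dvd_power_iff mn)
    qed
    \<comment> \<open>The prime \<open>q\<close> occurs in \<open>V\<close> but not in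
      \<open>U\<close>. It yields \<open>n * x < m * y\<close>, an inequality without primes, which
      \<open>val\<close> then carries to all primes of \<open>a\<close>.\<close>
    have "m * (n * multiplicity q h) < m * (n * multiplicity q h + multiplicity q V)"
      using q UV mn by (simp add: prime_multiplicity_gt_zero_iff)
    then have "n * (x * multiplicity q a) < m * (y * multiplicity q a)"
      using vU[OF q(1)] vV[OF q(1)] qU by (simp add: not_dvd_imp_multiplicity_0 ac_simps)
    then have yx: "n * x < m * y" by (metis mult.assoc mult_less_cancel2)
    have val: "n * multiplicity q U < m * multiplicity q V" if "prime q" "q dvd a" for q
    proof -
      have "multiplicity q a > 0" using that a by (simp add: prime_multiplicity_gt_zero_iff)
      then have "n * x * multiplicity q a < m * y * multiplicity q a" using yx by simp
      then have "n * (x * multiplicity q a) < m * (y * multiplicity q a)" by (simp add: mult.assoc)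
      then show ?thesis unfolding vU[OF that(1)] vV[OF that(1)] by (simp add: algebra_simps)
    qed
    have dvdV: "q dvd V" if "prime q" "q dvd a" for q
      using val[OF that] by (metis mult_0_right not_dvd_imp_multiplicity_0 not_less_zero)
    \<comment> \<open>For \<open>m > 1\<close> each prime of \<open>U\<close> divides
      \<open>a\<close>, hence \<open>V\<close>, hence \<open>r - s\<close>, so the Zsigmondy case
      gives \<open>m = 2\<close> and odd \<open>r\<close>, \<open>s\<close>. Then \<open>n\<close>
      is odd, and \<open>V\<close> has no more factors 2 than \<open>U\<close>, against
      \<open>val\<close>.\<close>
    have m1: "m = 1"
    proof (rule ccontr)
      assume "m \<noteq> 1"
      then have "m > 1" using mn by simp
      have "q dvd r - s" if "prime q" "q dvd r ^ m - s ^ m" for q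
        using that dvda[of q] dvdV common by (auto simp: U_def)
      then have m2: "m = 2" and par: "odd r" "odd s"
        using prime_divisors_of_power_diff[OF r s rs(3) \<open>m > 1\<close>] by auto
      have on: "odd n" using mn m2 by simp
      have "even (r - s)" using par by simp
      then have "2 dvd U" using rsU dvd_trans by blast
      then have a2: "2 dvd a" using dvda[of 2] by simp
      have "multiplicity 2 V = multiplicity 2 (r - s)"
        using lifting_the_exponent_nat[of 2 r s n] par r n on
        by (simp add: V_def not_dvd_imp_multiplicity_0)
      moreover have "multiplicity 2 (r - s) \<le> multiplicity 2 U"
        using rsU UV by (intro dvd_imp_multiplicity_le) auto
      ultimately have "m * multiplicity 2 V \<le> n * multiplicity 2 U"
        using mn by (simp add: mult_mono)
      then show False using val[of 2] a2 by simp
    qed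
    have U: "U = r - s" by (simp add: U_def m1)
    \<comment> \<open>At an odd prime of \<open>r - s\<close>, lifting turns \<open>val\<close> into
      \<open>(n - 1) * multiplicity q (r - s) < multiplicity q n\<close>, while
      \<open>multiplicity q n < n\<close>.\<close>
    have only2: "q = 2" if "prime q" "q dvd r - s" for q
    proof (rule ccontr)
      assume "q \<noteq> 2"
      have "\<not> q dvd s" using nd[of q 1] that by simp
      then have "multiplicity q V = multiplicity q (r - s) + multiplicity q n"
        using lifting_the_exponent_nat[of q r s n] that r n \<open>q \<noteq> 2\<close> by (simp add: V_def)
      moreover have "q dvd a" using dvda[of q] that U by simp
      ultimately have *: "n * multiplicity q (r - s) < multiplicity q (r - s) + multiplicity q n"
        using val[of q] that m1 U by simp
      have "multiplicity q (r - s) \<ge> 1"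
        using that r by (simp add: Suc_le_eq prime_multiplicity_gt_zero_iff)
      then have "(n - 1) * 1 \<le> (n - 1) * multiplicity q (r - s)" by (intro mult_mono) auto
      then have "n - 1 + multiplicity q (r - s) \<le> n * multiplicity q (r - s)"
        using n by (simp add: diff_mult_distrib)
      then show False using * multiplicity_nat_less[OF that(1), of n] n by linarith
    qed
    obtain e where e: "r - s = 2 ^ e"
      using eq_prime_power_of_prime_divisors[of 2 "r - s"] only2 r by auto
    have yx': "n * x < y" using yx m1 by simp
    then have ay: "a ^ y = a ^ (n * x) * a ^ (y - n * x)" by (simp flip: power_add)
    show ?thesis
    proof (cases "e = 0")
      case True
      then have r1: "r = s + 1" using e r by simp
      then have ha: "h = a ^ x" using ex U m1 by simp
      then have "a ^ (n * x) * V = a ^ (n * x) * a ^ (y - n * x)"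
        using ey ay by (metis mult.commute power_mult)
      then have V: "V = a ^ (y - n * x)" using a by simp
      have "odd V" using r1 lt n unfolding V_def by simp
      then have "odd a" using V yx' by simp
      moreover have "(s + 1) ^ n = s ^ n + a ^ (y - n * x)" using V lt r1 unfolding V_def by simp
      ultimately show ?thesis using m1 r1 ha rs s yx' by blast
    next
      case False
      then have ev: "even (r - s)" using e by simp
      then have same: "even r \<longleftrightarrow> even s" using r by (simp add: even_diff_nat)
      have "\<not> (even r \<and> even s)"
        using rs(3) coprime_common_divisor[of r s 2] by auto
      then have par: "odd r" "odd s" using same by auto
      have "2 dvd h * U * V" unfolding U by (intro dvd_mult2 dvd_mult ev)
      then have a2: "2 dvd a" using dvda[of 2] by simp
      have me: "multiplicity 2 (r - s) = e" using e by (simp add: multiplicity_same_power)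
      have v2: "n * e < multiplicity 2 V" using val[of 2] a2 m1 U me by simp
      have evn: "even n"
      proof (rule ccontr)
        assume "odd n"
        then have "multiplicity 2 V = e"
          using lifting_the_exponent_nat[of 2 r s n] par r n me
          by (simp add: V_def not_dvd_imp_multiplicity_0)
        then show False using v2 n by simp
      qed
      have mV: "multiplicity 2 V + 1 = e + multiplicity 2 (r + s) + multiplicity 2 n"
        using multiplicity_two_power_diff[OF r par evn] n me by (simp add: V_def)
      \<comment> \<open>For \<open>e \<ge> 2\<close> the number \<open>r + s\<close> has a single
        factor 2, which leaves \<open>V\<close> with \<open>e + multiplicity 2 n\<close> factors 2,
        too few for \<open>v2\<close>.\<close>
      have e1': "e = 1"
      proof (rule ccontr)
        assume "e \<noteq> 1"
        then have "e \<ge> 2" using False by simp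
        then have "4 dvd r - s" using e by (metis le_imp_power_dvd power2_eq_square numeral_Bit0_eq_double mult_2)
        then have "\<not> 4 dvd r + s" using par r by presburger
        then have "multiplicity 2 (r + s) = 1"
          using par by (intro multiplicity_eqI) auto
        then have "n * e < e + multiplicity 2 n" using mV v2 by simp
        moreover have "e + n \<le> n * e + 1"
        proof -
          have "(n - 1) * 1 \<le> (n - 1) * e" using \<open>e \<ge> 2\<close> by (intro mult_mono) auto
          then show ?thesis using n by (simp add: diff_mult_distrib)
        qed
        ultimately show False using multiplicity_nat_less[of 2 n] n by simp
      qed
      then have r2: "r = s + 2" using e r by simp
      then have ha: "2 * h = a ^ x" using ex U m1 by simp
      have "a ^ (n * x) * V = (2 * h) ^ n * V" using ha by (metis mult.commute power_mult)
      also have "\<dots> = a ^ (n * x) * (2 ^ n * a ^ (y - n * x))"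
        using ey ay by (simp add: power_mult_distrib)
      finally have V: "V = 2 ^ n * a ^ (y - n * x)" using a by simp
      then have "(s + 2) ^ n = s ^ n + 2 ^ n * a ^ (y - n * x)" using lt r2 unfolding V_def by simp
      \<comment> \<open>The prime that does not divide the even number \<open>r - s\<close> is the
        odd prime of \<open>a\<close> asked for in the third outcome.\<close>
      moreover have "odd q"
        using q ev primes_dvd_imp_eq two_is_prime_nat by blast
      ultimately show ?thesis using m1 par ha r2 rs yx' evn q qa by blast
    qed
  qed
qed

section \<open>Sums of proportional powers\<close>

text \<open>The norms (r^p + s^p)^(1/p) decrease strictly in p; raising to the power
  \<open>m * n\<close> removes the roots.\<close>

lemma power_sum_strict_mono:
  fixes r s m n :: nat
  assumes "s < r" "s > 0" "0 < m" "m < n"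
  shows "(r ^ n + s ^ n) ^ m < (r ^ m + s ^ m) ^ n"
proof -
  let ?S = "r ^ m + s ^ m"
  have "s ^ (n - m) < r ^ (n - m)" using assms by (simp add: power_strict_mono)
  then have "s ^ m * s ^ (n - m) < s ^ m * r ^ (n - m)" using assms by simp
  moreover have "s ^ m * s ^ (n - m) = s ^ n" "r ^ m * r ^ (n - m) = r ^ n"
    using assms by (auto simp flip: power_add)
  ultimately have "r ^ n + s ^ n < ?S * r ^ (n - m)" by (simp add: algebra_simps)
  then have "(r ^ n + s ^ n) ^ m < (?S * r ^ (n - m)) ^ m" using assms by (simp add: power_strict_mono)
  also have "\<dots> = ?S ^ m * (r ^ m) ^ (n - m)"
    by (simp add: power_mult_distrib mult.commute flip: power_mult)
  also have "\<dots> \<le> ?S ^ m * ?S ^ (n - m)" by (intro mult_left_mono power_mono) auto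
  also have "\<dots> = ?S ^ n" using assms by (simp flip: power_add)
  finally show ?thesis .
qed

text \<open>For \<open>s < r\<close> the decrease of the norms gives \<open>m * y < n * x\<close>,
  so at each prime of \<open>c\<close> the part \<open>S\<close> is the richer one and contains that
  prime. Hence \<open>T\<close> has no prime that is missing from \<open>S\<close>, which leads to
  2^3 + 1^3. For \<open>r = s\<close> both parts equal 2.\<close>

lemma power_sum_pair_ordered:
  fixes r0 s0 c x y m n :: nat
  assumes mn: "coprime m n" "m > 0" "m < n" and c: "c > 1" and s0: "s0 > 0" "s0 \<le> r0"
    and e1: "r0 ^ m + s0 ^ m = c ^ x" and e2: "r0 ^ n + s0 ^ n = c ^ y"
    and gcd: "gcd r0 s0 > 1"
  shows "(\<exists>e f. r0 = 2 ^ e \<and> s0 = 2 ^ e \<and> c = 2 ^ f) \<or>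
    (m = 1 \<and> n = 3 \<and> (\<exists>t>0. r0 = 2 * 3 ^ t \<and> s0 = 3 ^ t))"
proof -
  define h where "h = gcd r0 s0"
  have h1: "h > 1" using gcd h_def by simp
  obtain r s where rs: "r0 = h * r" "s0 = h * s" "coprime r s"
    using gcd_coprime_exists[of r0 s0] h1 h_def by (metis mult.commute less_nat_zero_code)
  have s: "s > 0" "s \<le> r" using s0 rs h1 by auto
  define S T where "S = r ^ m + s ^ m" and "T = r ^ n + s ^ n"
  have ST: "S > 0" "T > 0" using s by (simp_all add: S_def T_def)
  have ex: "c ^ x = h ^ m * S"
    using e1 by (simp add: S_def rs power_mult_distrib algebra_simps)
  have ey: "c ^ y = h ^ n * T"
    using e2 by (simp add: T_def rs power_mult_distrib algebra_simps)
  have vS: "x * multiplicity q c = m * multiplicity q h + multiplicity q S" if "prime q" for q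
    using that c h1 ST multiplicity_mult_power[of q h S m]
    by (simp flip: ex add: prime_elem_multiplicity_power_distrib)
  have vT: "y * multiplicity q c = n * multiplicity q h + multiplicity q T" if "prime q" for q
    using that c h1 ST multiplicity_mult_power[of q h T n]
    by (simp flip: ey add: prime_elem_multiplicity_power_distrib)
  have n: "n > 1" using mn by simp
  have dvdc: "q dvd c" if "prime q" "q dvd h * S * T" for q
  proof -
    have "q dvd c ^ x \<or> q dvd c ^ y"
      using that mn n unfolding ex ey by (auto simp: prime_dvd_mult_iff prime_dvd_power_iff)
    then show ?thesis using that(1) prime_dvd_power by blast
  qed
  have powc: "\<exists>f. N = p ^ f" if "prime p" "\<And>q. prime q \<Longrightarrow> q dvd c \<Longrightarrow> q = p" "N = c \<or> N = h" for p N
    using eq_prime_power_of_prime_divisors[of p N] that dvdc c h1 by (metis dvd_mult2 gr_implies_not0 neq0_conv)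
  have cpos: "multiplicity q c > 0" if "prime q" "q dvd c" for q
    using that c by (simp add: prime_multiplicity_gt_zero_iff)
  show ?thesis
  proof (cases "r = s")
    case True
    then have rs1: "r = 1" "s = 1" using rs(3) by auto
    then have ST2: "S = 2" "T = 2" by (simp_all add: S_def T_def)
    \<comment> \<open>With \<open>S = T = 2\<close> the two sides differ by \<open>n - m\<close> at
      2 but agree at every odd prime, where an odd prime of \<open>c\<close> would force
      \<open>n * x = m * y\<close>.\<close>
    have ne: "n * (x * multiplicity 2 c) \<noteq> m * (y * multiplicity 2 c)"
      using vS[of 2] vT[of 2] mn by (simp add: ST2 algebra_simps)
    have only2: "q = 2" if "prime q" "q dvd c" for q
    proof (rule ccontr)
      assume "q \<noteq> 2"
      then have "\<not> q dvd 2" using that(1) primes_dvd_imp_eq two_is_prime_nat by blast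
      then have "n * (x * multiplicity q c) = m * (y * multiplicity q c)"
        using vS[OF that(1)] vT[OF that(1)] by (simp add: ST2 not_dvd_imp_multiplicity_0)
      then have "n * x = m * y" using cpos[OF that] by (simp flip: mult.assoc)
      then show False using ne by (simp flip: mult.assoc)
    qed
    obtain e where "h = 2 ^ e" using powc[of 2 h] only2 by auto
    moreover obtain f where "c = 2 ^ f" using powc[of 2 c] only2 by auto
    ultimately show ?thesis using rs rs1 by auto
  next
    case False
    then have lt: "s < r" using s by simp
    have "(r0 ^ n + s0 ^ n) ^ m < (r0 ^ m + s0 ^ m) ^ n"
      using power_sum_strict_mono[of s0 r0 m n] lt s0 mn rs h1 by simp
    then have "c ^ (m * y) < c ^ (n * x)"
      unfolding e1 e2 by (simp add: mult.commute flip: power_mult)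
    then have yx: "m * y < n * x" using c by simp
    have val: "m * multiplicity q T < n * multiplicity q S" if "prime q" "q dvd c" for q
    proof -
      have "m * y * multiplicity q c < n * x * multiplicity q c" using yx cpos[OF that] by simp
      then have "m * (y * multiplicity q c) < n * (x * multiplicity q c)" by (simp add: mult.assoc)
      then show ?thesis unfolding vS[OF that(1)] vT[OF that(1)] by (simp add: algebra_simps)
    qed
    have dvdS: "q dvd S" if "prime q" "q dvd c" for q
      using val[OF that] by (metis mult_0_right not_dvd_imp_multiplicity_0 not_less_zero)
    have nd: "\<not> q dvd s \<and> \<not> q dvd r" if "prime q" "q dvd r ^ k + s ^ k" "k > 0" for q k
    proof -
      have "q dvd s \<longleftrightarrow> q dvd r"
        using that by (metis dvd_add_left_iff dvd_add_right_iff prime_dvd_power_iff)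
      then show ?thesis using rs(3) that(1) by (metis coprime_common_divisor not_prime_unit)
    qed
    \<comment> \<open>Doubling the exponents turns both sums into divisors of differences, and
      \<open>gcd (2 * m) (2 * n) = 2\<close> leaves the squares.\<close>
    have sq: "q dvd r\<^sup>2 - s\<^sup>2" if "prime q" "q dvd T" for q
    proof -
      have *: "q dvd r ^ (2 * k) - s ^ (2 * k)" if "q dvd r ^ k + s ^ k" for k
      proof -
        have "r ^ (2 * k) - s ^ (2 * k) = (r ^ k + s ^ k) * (r ^ k - s ^ k)"
          unfolding mult.commute[of 2 k] power_mult by (rule square_diff_nat)
        then show ?thesis using that by simp
      qed
      have "q dvd c" using dvdc that by simp
      then have "q dvd S" using dvdS that by simp
      moreover have "gcd (2 * m) (2 * n) = 2" using mn by (simp add: gcd_mult_distrib_nat[symmetric])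
      ultimately show ?thesis
        using prime_dvd_power_diff_gcd[of q s "2 * m" r "2 * n"] * nd[of q n] that mn lt n
        by (simp add: S_def T_def)
    qed
    have T2: "T > 2"
    proof -
      have "r ^ 1 \<le> r ^ n" using n lt by (intro power_increasing) auto
      then have "2 \<le> r ^ n" using lt s by simp
      moreover have "1 \<le> s ^ n" using s by simp
      ultimately show ?thesis unfolding T_def by linarith
    qed
    \<comment> \<open>For even \<open>n\<close> each prime of \<open>T\<close> also divides
      \<open>r ^ n - s ^ n\<close>, hence \<open>2 * r ^ n\<close>, so \<open>T\<close> is a power
      of 2 above 2. But then \<open>r\<close>, \<open>s\<close> are odd and \<open>T\<close> is 2
      modulo 4.\<close>
    have "odd n"
    proof
      assume ev: "even n"
      then obtain k where k: "n = 2 * k" by blast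
      have "q = 2" if "prime q" "q dvd T" for q
      proof -
        have "r\<^sup>2 - s\<^sup>2 dvd r ^ n - s ^ n"
          unfolding k power_mult by (rule diff_dvd_power_diff_nat)
        then have "q dvd r ^ n - s ^ n" using sq[OF that] dvd_trans by blast
        then have "q dvd (r ^ n + s ^ n) + (r ^ n - s ^ n)" using that by (simp add: T_def)
        moreover have "(r ^ n + s ^ n) + (r ^ n - s ^ n) = 2 * r ^ n"
          using lt by (simp add: power_mono less_imp_le)
        ultimately have "q dvd 2"
          using that nd[of q n] n by (auto simp: T_def prime_dvd_mult_iff prime_dvd_power_iff)
        then show ?thesis using that(1) primes_dvd_imp_eq two_is_prime_nat by blast
      qed
      then obtain f where f: "T = 2 ^ f" using eq_prime_power_of_prime_divisors[of 2 T] ST by auto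
      have f2: "f \<ge> 2"
      proof (rule ccontr)
        assume "\<not> f \<ge> 2"
        then have "f = 0 \<or> f = 1" by linarith
        then show False using f T2 by auto
      qed
      have four: "4 dvd T" using f2 f by (metis le_imp_power_dvd power2_eq_square numeral_Bit0_eq_double mult_2)
      then have "even T" by presburger
      then have "odd s \<and> odd r" using nd[OF two_is_prime_nat _ less_trans[OF zero_less_one n]] T_def by blast
      then have "odd r" "odd s" by blast+
      have one: "[u ^ n = 1] (mod 4)" if u: "odd u" for u :: nat
      proof -
        obtain j where "u = 2 * j + 1" using u by (elim oddE)
        then have "u\<^sup>2 = 4 * (j * j + j) + 1" by (simp add: power2_eq_square algebra_simps)
        then have "[u\<^sup>2 = 1] (mod 4)" by (simp add: cong_def)
        then have "[(u\<^sup>2) ^ k = 1 ^ k] (mod 4)" by (rule cong_pow)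
        then show ?thesis by (simp add: k power_mult)
      qed
      have "[T = 1 + 1] (mod 4)"
        unfolding T_def by (intro cong_add one \<open>odd r\<close> \<open>odd s\<close>)
      then show False using four by (auto simp: cong_def)
    qed
    have "q dvd r + s" if "prime q" "q dvd r ^ n + s ^ n" for q
    proof -
      have "(r + s) * (r - s) = r\<^sup>2 - s\<^sup>2"
        by (simp only: square_diff_nat)
      then have "q dvd (r + s) * (r - s)" using sq that T_def by simp
      then have "q dvd r + s \<or> q dvd r - s" using that(1) prime_dvd_mult_iff by blast
      then show ?thesis
      proof
        \<comment> \<open>Then \<open>q\<close> divides \<open>2 * r ^ n\<close>, so
          \<open>q = 2\<close>, and \<open>r + s\<close> has the parity of
          \<open>r - s\<close>.\<close>
        assume d: "q dvd r - s"
        then have "q dvd r ^ n - s ^ n" using diff_dvd_power_diff_nat dvd_trans by blast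
        then have "q dvd (r ^ n + s ^ n) + (r ^ n - s ^ n)" using that by simp
        moreover have "(r ^ n + s ^ n) + (r ^ n - s ^ n) = 2 * r ^ n"
          using lt by (simp add: power_mono less_imp_le)
        ultimately have "q dvd 2"
          using that nd[of q n] n by (auto simp: prime_dvd_mult_iff prime_dvd_power_iff)
        then have "q = 2" using that(1) primes_dvd_imp_eq two_is_prime_nat by blast
        then show ?thesis using d lt by presburger
      qed
    qed
    then have res: "n = 3" "r = 2" "s = 1"
      using prime_divisors_of_power_sum[OF lt s(1) rs(3) n \<open>odd n\<close>] by auto
    have T9: "T = 9" using res by (simp add: T_def)
    then have "3 dvd c" using dvdc[of 3] by simp
    then have S3: "3 dvd S" using dvdS by simp
    have m1: "m = 1"
    proof (rule ccontr)
      assume "m \<noteq> 1"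
      then have "m = 2" using mn res by simp
      then show False using S3 res by (simp add: S_def)
    qed
    have "q = 3" if "prime q" "q dvd c" for q
      using dvdS[OF that] that(1) by (simp add: S_def res m1 primes_dvd_imp_eq)
    then obtain t where t: "h = 3 ^ t" using powc[of 3 h] by auto
    have "t > 0" using h1 t by (cases t) auto
    then show ?thesis using m1 res t rs by auto
  qed
qed

lemma power_sum_pair:
  fixes r0 s0 c x y m n :: nat
  assumes mn: "coprime m n" "m > 0" "m < n" and c: "c > 1" and "s0 > 0" "r0 > 0"
    and e1: "r0 ^ m + s0 ^ m = c ^ x" and e2: "r0 ^ n + s0 ^ n = c ^ y"
    and gcd: "gcd r0 s0 > 1"
  shows "(\<exists>e f. r0 = 2 ^ e \<and> s0 = 2 ^ e \<and> c = 2 ^ f) \<or>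
    (m = 1 \<and> n = 3 \<and> (\<exists>t>0. {r0, s0} = {2 * 3 ^ t, 3 ^ t}))"
proof (cases "s0 \<le> r0")
  case True
  then show ?thesis using power_sum_pair_ordered[OF mn c _ _ e1 e2 gcd] assms by auto
next
  case False
  then show ?thesis
    using power_sum_pair_ordered[OF mn c, of r0 s0 x y] assms by (auto simp: gcd.commute add.commute)
qed

section \<open>The size comparison\<close>

text \<open>Sizes are measured relative to valuations. In the first solution
  \<open>a ^ x < c ^ z\<close> while its valuation is at least that of \<open>c ^ z\<close>, so
  \<open>a ^ \<gamma> < c ^ \<alpha>\<close>, and likewise
  \<open>b ^ \<gamma> < c ^ \<beta>\<close>. In the second one both terms have valuation
  \<open>N\<close>, so their \<gamma>-th powers lie below \<open>c ^ N\<close>, yet the \<gamma>-th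
  power of their sum is at least \<open>c ^ (N + 1)\<close>. Adding two terms gains at most
  \<open>2 ^ \<gamma>\<close>, so \<open>c < 2 ^ \<gamma>\<close>, although
  \<open>p ^ \<gamma>\<close> divides \<open>c\<close>.\<close>

lemma type_C_excluded:
  fixes a b c p x y z x' y' z' :: nat
  assumes p: "prime p" "p dvd c" and abc: "a > 1" "b > 1" "c > 1"
    and sol: "a ^ x + b ^ y = c ^ z" "z > 0" and sol': "a ^ x' + b ^ y' = c ^ z'" "x' > 0" "y' > 0"
    and pos: "multiplicity p a > 0" "multiplicity p b > 0"
    and t: "multiplicity p a * x \<ge> multiplicity p c * z" "multiplicity p b * y \<ge> multiplicity p c * z"
    and t': "multiplicity p a * x' = multiplicity p b * y'" "multiplicity p b * y' < multiplicity p c * z'"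
  shows False
proof -
  define \<alpha> \<beta> \<gamma> where d: "\<alpha> = multiplicity p a" "\<beta> = multiplicity p b" "\<gamma> = multiplicity p c"
  have g: "\<gamma> > 0" using p abc by (simp add: d prime_multiplicity_gt_zero_iff)
  have *: "u ^ \<gamma> < c ^ \<delta>" if "u ^ v < c ^ z" "\<delta> * v \<ge> \<gamma> * z" "u > 1" "\<delta> > 0" for u v \<delta>
  proof -
    have "u ^ (\<gamma> * z) \<le> u ^ (\<delta> * v)" using that by (intro power_increasing) auto
    also have "\<dots> = (u ^ v) ^ \<delta>" by (simp add: mult.commute flip: power_mult)
    also have "\<dots> < (c ^ z) ^ \<delta>" using that by (intro power_strict_mono) auto
    finally have "(u ^ \<gamma>) ^ z < (c ^ \<delta>) ^ z" by (simp add: mult.commute flip: power_mult)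
    then show ?thesis using power_less_imp_less_base by blast
  qed
  have "a ^ x < c ^ z" "b ^ y < c ^ z" using sol(1) abc by (simp_all flip: sol(1))
  then have ab: "a ^ \<gamma> < c ^ \<alpha>" "b ^ \<gamma> < c ^ \<beta>"
    using *[of a x \<alpha>] *[of b y \<beta>] t pos abc by (auto simp: d)
  define N where "N = \<alpha> * x'"
  have N: "N = \<beta> * y'" "N < \<gamma> * z'" using t' by (auto simp: N_def d)
  define M where "M = max (a ^ x') (b ^ y')"
  have bd: "(a ^ x') ^ \<gamma> < c ^ N" "(b ^ y') ^ \<gamma> < c ^ N"
  proof -
    have "(a ^ x') ^ \<gamma> = (a ^ \<gamma>) ^ x'" by (simp add: mult.commute flip: power_mult)
    also have "\<dots> < (c ^ \<alpha>) ^ x'" using ab sol' by (intro power_strict_mono) auto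
    finally show "(a ^ x') ^ \<gamma> < c ^ N" by (simp add: N_def power_mult)
    have "(b ^ y') ^ \<gamma> = (b ^ \<gamma>) ^ y'" by (simp add: mult.commute flip: power_mult)
    also have "\<dots> < (c ^ \<beta>) ^ y'" using ab sol' by (intro power_strict_mono) auto
    finally show "(b ^ y') ^ \<gamma> < c ^ N" by (simp add: N power_mult)
  qed
  then have M: "M ^ \<gamma> < c ^ N" by (simp add: M_def max_def)
  have "c * c ^ N \<le> c ^ (\<gamma> * z')"
    using N abc by (metis Suc_leI less_imp_le power_Suc power_increasing)
  also have "\<dots> = (a ^ x' + b ^ y') ^ \<gamma>" by (simp add: sol'(1) mult.commute flip: power_mult)
  also have "\<dots> \<le> (2 * M) ^ \<gamma>" by (intro power_mono) (auto simp: M_def)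
  also have "\<dots> = 2 ^ \<gamma> * M ^ \<gamma>" by (simp add: power_mult_distrib)
  also have "\<dots> < 2 ^ \<gamma> * c ^ N" using M by simp
  finally have "c < 2 ^ \<gamma>" using abc by simp
  moreover have "p ^ \<gamma> dvd c" by (simp add: d multiplicity_dvd)
  then have "p ^ \<gamma> \<le> c" using abc by (intro dvd_imp_le) auto
  moreover have "(2::nat) ^ \<gamma> \<le> p ^ \<gamma>" using prime_ge_2_nat[OF p(1)] by (intro power_mono) auto
  ultimately show False by linarith
qed

section \<open>Solutions with proportional exponents\<close>

text \<open>The shapes are families (i), (iii), (iv) read off from \<open>a\<close>, \<open>b\<close>, \<open>c\<close> themselves rather than
  up to correspondence. They are not symmetric in \<open>a\<close> and \<open>b\<close>.\<close>

definition shape_i :: "nat \<Rightarrow> nat \<Rightarrow> nat \<Rightarrow> triple \<Rightarrow> triple \<Rightarrow> bool" where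
  "shape_i a b c = (\<lambda>(x, y, z) (x', y', z'). \<exists>F e. F > 0 \<and> e > 0 \<and> y' = 2 * y \<and> z' = 2 * z \<and>
     b ^ y = 2 ^ e * (2 ^ F - 1) \<and> c ^ z = 2 ^ e * (2 ^ F + 1) \<and>
     a ^ x = 2 ^ (e + 1) \<and> a ^ x' = 2 ^ (2 * e + F + 2))"

definition shape_iii :: "nat \<Rightarrow> nat \<Rightarrow> nat \<Rightarrow> triple \<Rightarrow> triple \<Rightarrow> bool" where
  "shape_iii a b c = (\<lambda>(x, y, z) (x', y', z'). \<exists>k s. k > 1 \<and> y' = k * y \<and> z' = k * z \<and> s > 0 \<and>
     b ^ y = a ^ x * s \<and> c ^ z = a ^ x * (s + 1) \<and> k * x < x' \<and>
     (s + 1) ^ k = s ^ k + a ^ (x' - k * x) \<and> odd a)"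

definition shape_iv :: "nat \<Rightarrow> nat \<Rightarrow> nat \<Rightarrow> triple \<Rightarrow> triple \<Rightarrow> bool" where
  "shape_iv a b c = (\<lambda>(x, y, z) (x', y', z'). \<exists>k s h. k > 1 \<and> even k \<and> y' = k * y \<and> z' = k * z \<and> odd s \<and>
     2 * h = a ^ x \<and> b ^ y = h * s \<and> c ^ z = h * (s + 2) \<and> k * x < x' \<and>
     (s + 2) ^ k = s ^ k + 2 ^ k * a ^ (x' - k * x) \<and> (\<exists>q. prime q \<and> odd q \<and> q dvd a))"

text \<open>Here \<open>m : n\<close> is the common ratio in lowest terms; the two solutions then
  involve the \<open>m\<close>-th and the \<open>n\<close>-th powers of one fixed pair of
  numbers.\<close>

lemma proportional_exponents:
  fixes y1 y2 z1 z2 :: nat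
  assumes "y1 * z2 = y2 * z1" "y1 > 0"
  obtains m n t u where "coprime m n" "y1 = m * t" "y2 = n * t" "z1 = m * u" "z2 = n * u"
proof -
  obtain m n where mn: "y1 = m * gcd y1 y2" "y2 = n * gcd y1 y2" "coprime m n"
    using gcd_coprime_exists[of y1 y2] assms(2) by auto
  have "m * z2 * gcd y1 y2 = n * z1 * gcd y1 y2"
    using assms(1) mn by (metis mult.assoc mult.commute)
  then have eq: "m * z2 = n * z1" using assms(2) by simp
  then have "m dvd z1" using mn(3) by (metis coprime_dvd_mult_right_iff dvd_triv_left)
  then obtain u where u: "z1 = m * u" by blast
  have "m > 0" using mn(1) assms(2) by (metis gr0I mult_zero_left)
  then have "z2 = n * u" using eq u by simp
  then show ?thesis using that mn u by blast
qed

lemma yz_proportional_ordered: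
  fixes a b c t u :: nat
  assumes abc: "a > 1" "b > 1" "c > 1" and p: "prime p" "p dvd b" "p dvd c"
    and s1: "is_solution (a, b, c) (x1, m * t, m * u)" and s2: "is_solution (a, b, c) (x2, n * t, n * u)"
    and mn: "coprime m n" "m < n"
  shows "shape_i a b c (x1, m * t, m * u) (x2, n * t, n * u) \<or>
    shape_iii a b c (x1, m * t, m * u) (x2, n * t, n * u) \<or>
    shape_iv a b c (x1, m * t, m * u) (x2, n * t, n * u)"
proof -
  have pos: "m > 0" "t > 0" "u > 0" using s1 by auto
  have e1: "(c ^ u) ^ m = (b ^ t) ^ m + a ^ x1" and e2: "(c ^ u) ^ n = (b ^ t) ^ n + a ^ x2"
    using s1 s2 by (simp_all add: mult.commute flip: power_mult)
  have "p dvd gcd (c ^ u) (b ^ t)" using p pos by (simp add: prime_dvd_power_iff)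
  moreover have "gcd (c ^ u) (b ^ t) > 0" using abc by simp
  ultimately have g: "gcd (c ^ u) (b ^ t) > 1"
    using prime_gt_1_nat[OF p(1)] dvd_imp_le by (meson less_le_trans)
  have b: "b ^ t > 0" using abc by simp
  note res = power_difference_pair[OF mn(1) pos(1) mn(2) abc(1) b e1 e2 g]
  then have m1: "m = 1" by blast
  then have n: "n > 1" using mn by simp
  consider F e where "F > 0" "e > 0" "n = 2" "c ^ u = 2 ^ e * (2 ^ F + 1)" "b ^ t = 2 ^ e * (2 ^ F - 1)"
    | s where "s > 0" "c ^ u = a ^ x1 * (s + 1)" "b ^ t = a ^ x1 * s" "n * x1 < x2"
        "(s + 1) ^ n = s ^ n + a ^ (x2 - n * x1)" "odd a"
    | h s where "odd s" "2 * h = a ^ x1" "c ^ u = h * (s + 2)" "b ^ t = h * s" "n * x1 < x2"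
        "(s + 2) ^ n = s ^ n + 2 ^ n * a ^ (x2 - n * x1)" "even n" "\<exists>q. prime q \<and> odd q \<and> q dvd a"
    using res by blast
  then show ?thesis
  proof cases
    case 1
    \<comment> \<open>With \<open>w\<close> the two numbers are \<open>2 ^ e * w\<close> and
      \<open>2 ^ e * (w + 2)\<close>, and (w + 2)^2 - w^2 = 4 * (w + 1) is a power of 2; this avoids
      truncated subtraction.\<close>
    define w where "w = (2::nat) ^ F - 1"
    have w: "2 ^ F = w + 1" by (simp add: w_def)
    have "a ^ x1 = 2 ^ (e + 1)" using e1 1 m1 w by (simp add: algebra_simps)
    moreover have "a ^ x2 = 2 ^ (2 * e + F + 2)"
    proof -
      have "(2 ^ e * (w + 2))\<^sup>2 = (2 ^ e * w)\<^sup>2 + a ^ x2"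
        using e2 unfolding 1 w by (simp add: add.commute w_def)
      moreover have "(2 ^ e * (w + 2))\<^sup>2 = (2 ^ e * w)\<^sup>2 + (2 ^ e)\<^sup>2 * (2 ^ F) * 4"
        unfolding w by (simp add: power2_eq_square algebra_simps)
      ultimately have "a ^ x2 = (2 ^ e)\<^sup>2 * (2 ^ F) * 4" by linarith
      also have "\<dots> = 2 ^ (2 * e + F + 2)" by (simp add: power_add power_mult power2_eq_square mult_2)
      finally show ?thesis .
    qed
    ultimately have "shape_i a b c (x1, m * t, m * u) (x2, n * t, n * u)"
      unfolding shape_i_def using 1 m1 by auto
    then show ?thesis by blast
  next
    case 2
    then have "shape_iii a b c (x1, m * t, m * u) (x2, n * t, n * u)"
      unfolding shape_iii_def using m1 n by auto
    then show ?thesis by blast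
  next
    case 3
    then have "shape_iv a b c (x1, m * t, m * u) (x2, n * t, n * u)"
      unfolding shape_iv_def using m1 n by auto
    then show ?thesis by blast
  qed
qed

lemma yz_proportional:
  fixes a b c :: nat
  assumes abc: "a > 1" "b > 1" "c > 1" and p: "prime p" "p dvd b" "p dvd c"
    and s1: "is_solution (a, b, c) (x1, y1, z1)" and s2: "is_solution (a, b, c) (x2, y2, z2)"
    and ne: "(x1, y1, z1) \<noteq> (x2, y2, z2)" and pr: "y1 * z2 = y2 * z1"
  obtains S S' where "(S, S') = ((x1, y1, z1), (x2, y2, z2)) \<or> (S, S') = ((x2, y2, z2), (x1, y1, z1))"
    "shape_i a b c S S' \<or> shape_iii a b c S S' \<or> shape_iv a b c S S'"
proof -
  obtain m n t u where mn: "coprime m n" "y1 = m * t" "y2 = n * t" "z1 = m * u" "z2 = n * u"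
    by (rule proportional_exponents[OF pr]) (use s1 in auto)
  have "m \<noteq> n"
  proof
    assume "m = n"
    then have "y1 = y2" "z1 = z2" using mn by auto
    then have "a ^ x1 = a ^ x2" using s1 s2 by auto
    then show False using ne \<open>y1 = y2\<close> \<open>z1 = z2\<close> abc by auto
  qed
  then consider "m < n" | "n < m" by linarith
  then show thesis
  proof cases
    case 1
    then show ?thesis using yz_proportional_ordered[OF abc p, of x1 m t u x2 n] s1 s2 mn that by blast
  next
    case 2
    then show ?thesis
      using yz_proportional_ordered[OF abc p, of x2 n t u x1 m] s1 s2 mn that coprime_commute by blast
  qed
qed

lemma power_of_prime_base:
  fixes b p :: nat
  assumes "prime p" "b ^ t = p ^ e" "t > 0" "b > 0"
  obtains j where "b = p ^ j"
proof -
  have "q = p" if "prime q" "q dvd b" for q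
  proof -
    have "q dvd p ^ e" using that assms by (metis dvd_power dvd_trans)
    then show ?thesis using that assms by (meson prime_dvd_power primes_dvd_imp_eq)
  qed
  then show ?thesis using eq_prime_power_of_prime_divisors[of p b] assms that by blast
qed

lemma xy_proportional:
  fixes a b c :: nat
  assumes abc: "a > 1" "b > 1" "c > 1" and p: "prime p" "p dvd a" "p dvd b"
    and s1: "is_solution (a, b, c) (x1, y1, z1)" and s2: "is_solution (a, b, c) (x2, y2, z2)"
    and ne: "(x1, y1, z1) \<noteq> (x2, y2, z2)" and pr: "x1 * y2 = x2 * y1"
    and npow: "\<not> (\<exists>i j k. a = 2 ^ i \<and> b = 2 ^ j \<and> c = 2 ^ k)"
  shows "in_family family_ii (a, b, c) (x1, y1, z1) (x2, y2, z2)"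
proof -
  \<comment> \<open>Membership is shown for both orders of the solutions so that
    \<open>m < n\<close> may be assumed.\<close>
  have main: "in_family family_ii (a, b, c) (x1, y1, z1) (x2, y2, z2)
        \<and> in_family family_ii (a, b, c) (x2, y2, z2) (x1, y1, z1)"
    if s1: "is_solution (a, b, c) (x1, y1, z1)" and s2: "is_solution (a, b, c) (x2, y2, z2)"
      and mn: "coprime m n" "m < n" "x1 = m * t" "x2 = n * t" "y1 = m * u" "y2 = n * u"
      and ne: "(x1, y1, z1) \<noteq> (x2, y2, z2)"
    for x1 y1 z1 x2 y2 z2 m n t u
  proof -
    have pos: "m > 0" "t > 0" "u > 0" using s1 mn by auto
    have e1: "(a ^ t) ^ m + (b ^ u) ^ m = c ^ z1" and e2: "(a ^ t) ^ n + (b ^ u) ^ n = c ^ z2"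
      using s1 s2 mn by (simp_all add: mult.commute flip: power_mult)
    have "p dvd gcd (a ^ t) (b ^ u)" using p pos by (simp add: prime_dvd_power_iff)
    moreover have "gcd (a ^ t) (b ^ u) > 0" using abc by simp
    ultimately have g: "gcd (a ^ t) (b ^ u) > 1"
      using prime_gt_1_nat[OF p(1)] dvd_imp_le by (meson less_le_trans)
    have ab: "b ^ u > 0" "a ^ t > 0" using abc by simp_all
    consider e f where "a ^ t = 2 ^ e" "b ^ u = 2 ^ e" "c = 2 ^ f"
      | v where "m = 1" "n = 3" "v > 0" "{a ^ t, b ^ u} = {2 * 3 ^ v, 3 ^ v}"
      using power_sum_pair[OF mn(1) pos(1) mn(2) abc(3) ab e1 e2 g] by blast
    then show ?thesis
    proof cases
      \<comment> \<open>Two equal terms \<open>2 ^ e\<close>: the degenerate case removed by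
        \<open>npow\<close>.\<close>
      case 1
      obtain i where "a = 2 ^ i" using power_of_prime_base[OF _ 1(1)] pos abc by auto
      moreover obtain j where "b = 2 ^ j" using power_of_prime_base[OF _ 1(2)] pos abc by auto
      ultimately show ?thesis using npow 1 by blast
    next
      case 2
      have F: "((2 * 3 ^ v, 3, 3), (1, v, v + 1), (3, 3 * v, 3 * v + 2)) \<in> family_ii"
        unfolding family_ii_def using 2 by blast
      have c1: "corresponds (2 * 3 ^ v, 3, 3) (1, v, v + 1) (a, b, c) (x1, y1, z1)"
        using 2 mn by simp
      have "{(a ^ t) ^ 3, (b ^ u) ^ 3} = {(2 * 3 ^ v) ^ 3, (3 ^ v) ^ 3}"
        using arg_cong[OF 2(4), of "image (\<lambda>w. w ^ 3)"] by simp
      then have c2: "corresponds (2 * 3 ^ v, 3, 3) (3, 3 * v, 3 * v + 2) (a, b, c) (x2, y2, z2)"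
        using 2 mn by (simp add: mult.commute flip: power_mult)
      show ?thesis unfolding in_family_def using s1 s2 ne F c1 c2 by metis
    qed
  qed
  obtain m n t u where mn: "coprime m n" "x1 = m * t" "x2 = n * t" "y1 = m * u" "y2 = n * u"
    by (rule proportional_exponents[OF pr]) (use s1 in auto)
  have "m \<noteq> n"
  proof
    assume "m = n"
    then have "x1 = x2" "y1 = y2" using mn by auto
    then have "c ^ z1 = c ^ z2" using s1 s2 by auto
    then show False using ne \<open>x1 = x2\<close> \<open>y1 = y2\<close> abc by auto
  qed
  then consider "m < n" | "n < m" by linarith
  then show ?thesis
  proof cases
    case 1
    then show ?thesis using main[OF s1 s2 mn(1) 1 mn(2-5) ne] by blast
  next
    case 2
    have "coprime n m" using mn(1) coprime_commute by blast
    then show ?thesis using main[OF s2 s1 _ 2 mn(3,2,5,4)] ne by blast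
  qed
qed

section \<open>Shapes as members of the families\<close>

lemma shape_i_family:
  assumes "shape_i a b c S S'"
  obtains ABC S1 S2 where "(ABC, S1, S2) \<in> family_i"
    "corresponds ABC S1 (a, b, c) S" "corresponds ABC S2 (a, b, c) S'"
proof -
  obtain x y z x' y' z' where S: "S = (x, y, z)" "S' = (x', y', z')" by (metis surj_pair)
  obtain F e where *: "F > 0" "e > 0" "y' = 2 * y" "z' = 2 * z"
     "b ^ y = 2 ^ e * (2 ^ F - 1)" "c ^ z = 2 ^ e * (2 ^ F + 1)"
     "a ^ x = 2 ^ (e + 1)" "a ^ x' = 2 ^ (2 * e + F + 2)"
    using assms unfolding shape_i_def S by auto
  \<comment> \<open>Parameters of the family: \<open>u = e\<close> and
    \<open>h = F + 1\<close>.\<close>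
  let ?A = "(2, 2 ^ e * (2 ^ (F + 1 - 1) - 1), 2 ^ e * (2 ^ (F + 1 - 1) + 1)) :: triple"
  have "(?A, (e + 1, 1, 1), (2 * e + (F + 1) + 1, 2, 2)) \<in> family_i"
    unfolding family_i_def using *(1,2) by fastforce
  moreover have "corresponds ?A (e + 1, 1, 1) (a, b, c) S" using * by (simp add: S)
  moreover have "b ^ y' = (b ^ y)\<^sup>2" using *(3) by (simp add: mult.commute flip: power_mult)
  then have "corresponds ?A (2 * e + (F + 1) + 1, 2, 2) (a, b, c) S'"
    using * by (simp add: S)
  ultimately show ?thesis using that by blast
qed

lemma shape_iii_family:
  assumes "shape_iii a b c S S'" "fst S > 0" "a > 1"
  obtains ABC S1 S2 where "(ABC, S1, S2) \<in> family_iii"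
    "corresponds ABC S1 (a, b, c) S" "corresponds ABC S2 (a, b, c) S'"
proof -
  obtain x y z x' y' z' where S: "S = (x, y, z)" "S' = (x', y', z')" by (metis surj_pair)
  obtain k s where *: "k > 1" "y' = k * y" "z' = k * z" "s > 0"
     "b ^ y = a ^ x * s" "c ^ z = a ^ x * (s + 1)" "k * x < x'"
     "(s + 1) ^ k = s ^ k + a ^ (x' - k * x)" "odd a"
    using assms unfolding shape_iii_def S by auto
  define w where "w = x' - k * x"
  \<comment> \<open>Parameters of the family: \<open>g = a\<close>, \<open>j = 1\<close>,
    \<open>u = x\<close>, \<open>d = s\<close>.\<close>
  let ?A = "(a ^ 1, a ^ (1 * x) * s, a ^ (1 * x) * (s + 1))"
  have x: "x > 0" using assms S by simp
  have w: "(s + 1) ^ k - s ^ k = a ^ w" "w > 0" using *(7,8) by (simp_all add: w_def)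
  have "(?A, (x, 1, 1), (k * x + w div 1, k, k)) \<in> family_iii"
    unfolding family_iii_def
    by (intro CollectI, rule exI[of _ a], rule exI[of _ 1], rule exI[of _ x],
        rule exI[of _ s], rule exI[of _ k], rule exI[of _ w]) (use *(1,4,9) assms(3) x w in simp)
  moreover have "corresponds ?A (x, 1, 1) (a, b, c) S" using * by (simp add: S)
  moreover have "b ^ y' = (b ^ y) ^ k" using *(2) by (simp add: mult.commute flip: power_mult)
  then have "corresponds ?A (k * x + w div 1, k, k) (a, b, c) S'"
    using *(5,7) by (simp add: S w_def)
  ultimately show ?thesis using that by blast
qed

lemma shape_iv_family:
  assumes "shape_iv a b c S S'" "fst S > 0" "a > 1"
  obtains ABC S1 S2 where "(ABC, S1, S2) \<in> family_iv"
    "corresponds ABC S1 (a, b, c) S" "corresponds ABC S2 (a, b, c) S'"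
proof -
  obtain x y z x' y' z' where S: "S = (x, y, z)" "S' = (x', y', z')" by (metis surj_pair)
  obtain k s h q where *: "k > 1" "even k" "y' = k * y" "z' = k * z" "odd s"
     "2 * h = a ^ x" "b ^ y = h * s" "c ^ z = h * (s + 2)" "k * x < x'"
     "(s + 2) ^ k = s ^ k + 2 ^ k * a ^ (x' - k * x)" "prime q" "odd q" "q dvd a"
    using assms unfolding shape_iv_def S by auto
  have x: "x > 0" using assms S by simp
  define w where "w = x' - k * x"
  have w: "w > 0" using *(9) by (simp add: w_def)
  \<comment> \<open>The base is split as \<open>2 ^ i * g\<close> with \<open>g\<close> odd and
    \<open>j = 1\<close>; the odd prime \<open>q\<close> of the shape ensures
    \<open>g > 1\<close>.\<close>
  define i where "i = multiplicity 2 a"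
  obtain g where g: "a = 2 ^ i * g" "odd g"
    using multiplicity_decompose'[of a 2] assms(3) unfolding i_def by auto
  have "even (a ^ x)" using *(6) by (metis dvd_triv_left)
  then have "even a" by simp
  then have i: "i > 0" using assms(3) by (simp add: i_def prime_multiplicity_gt_zero_iff)
  have "q dvd g"
  proof -
    have "q dvd 2 ^ i \<or> q dvd g" using *(11,13) g(1) prime_dvd_mult_iff by metis
    moreover have "\<not> q dvd 2 ^ i"
      using *(11,12) by (metis prime_dvd_power primes_dvd_imp_eq two_is_prime_nat even_numeral)
    ultimately show ?thesis by blast
  qed
  then have g1: "g > 1" using *(11) prime_gt_1_nat dvd_imp_le g(2) by (metis even_zero less_le_trans neq0_conv)
  have ix: "i * x > 0" using i x by simp
  have "2 * h = 2 * (2 ^ (i * x - 1) * g ^ x)"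
  proof -
    have "2 * h = 2 ^ (i * x) * g ^ x" using *(6) g(1) by (simp add: power_mult_distrib power_mult)
    also have "(2::nat) ^ (i * x) = 2 * 2 ^ (i * x - 1)" using ix by (metis Suc_diff_1 power_Suc)
    finally show ?thesis by simp
  qed
  then have h: "h = 2 ^ (i * x - 1) * g ^ x" by simp
  define V where "V = (s + 2) ^ k - s ^ k"
  have V: "V = 2 ^ (k + i * w) * g ^ w"
    using *(10) unfolding V_def w_def[symmetric]
    by (simp add: g(1) power_mult_distrib power_add power_mult)
  have og: "odd (g ^ w)" using g by simp
  have max: "g ^ w = Max {m. odd m \<and> m dvd V}"
  proof (rule Max_eqI[symmetric])
    show "finite {m. odd m \<and> m dvd V}"
    proof (rule finite_subset)
      show "{m. odd m \<and> m dvd V} \<subseteq> {m. m dvd V}" by blast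
      show "finite {m. m dvd V}" using V g1 by (intro finite_divisors_nat) simp
    qed
    show "g ^ w \<in> {m. odd m \<and> m dvd V}" using og V by simp
    fix m assume "m \<in> {m. odd m \<and> m dvd V}"
    then have "odd m" "m dvd 2 ^ (k + i * w) * g ^ w" using V by auto
    moreover have "coprime m (2 ^ (k + i * w))" using \<open>odd m\<close> by simp
    ultimately have "m dvd g ^ w" using coprime_dvd_mult_right_iff by blast
    then show "m \<le> g ^ w" using g1 by (intro dvd_imp_le) auto
  qed
  \<comment> \<open>The relation counts the factors 2 of \<open>V\<close> twice: once from
    \<open>V = 2 ^ k * a ^ w\<close>, once by lifting at 2.\<close>
  have mult: "int k - int (multiplicity 2 k) = int (multiplicity 2 (2 * s + 2)) - int (i * (w div 1))"
  proof -
    have "multiplicity 2 V = k + i * w"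
      unfolding V using og by (intro multiplicity_eqI) auto
    moreover have "multiplicity 2 ((s + 2) ^ k - s ^ k) + 1
        = multiplicity 2 (s + 2 - s) + multiplicity 2 (s + 2 + s) + multiplicity 2 k"
      by (rule multiplicity_two_power_diff) (use * in auto)
    moreover have "s + 2 + s = 2 * s + 2" by simp
    ultimately have "k + i * w = multiplicity 2 (2 * s + 2) + multiplicity 2 k"
      by (simp add: V_def mult_2)
    then have "int (k + i * w) = int (multiplicity 2 (2 * s + 2) + multiplicity 2 k)" by simp
    then show ?thesis by simp
  qed
  let ?A = "(2 ^ i * g ^ 1, 2 ^ (i * x - 1) * g ^ (1 * x) * s, 2 ^ (i * x - 1) * g ^ (1 * x) * (s + 2))"
  have "(?A, (x, 1, 1), (k * x + w div 1, k, k)) \<in> family_iv"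
    unfolding family_iv_def
    by (intro CollectI, rule exI[of _ i], rule exI[of _ g], rule exI[of _ 1], rule exI[of _ x],
        rule exI[of _ s], rule exI[of _ k], rule exI[of _ w], intro conjI refl)
      (use i x *(1,2,5) g g1 w max mult odd_pos[OF *(5)] in \<open>simp_all add: V_def\<close>)
  moreover have "corresponds ?A (x, 1, 1) (a, b, c) S" using * h by (simp add: S g(1))
  moreover have "b ^ y' = (b ^ y) ^ k" using *(3) by (simp add: mult.commute flip: power_mult)
  then have "corresponds ?A (k * x + w div 1, k, k) (a, b, c) S'"
    using *(7,9) h by (simp add: S w_def flip: g(1))
  ultimately show ?thesis using that by blast
qed

section \<open>A further solution next to family (i)\<close>

lemma dvd_two_power_nat: "(d::nat) dvd 2 ^ F \<Longrightarrow> \<exists>i. d = 2 ^ i"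
  using divides_primepow_nat[of 2 d F] by auto

lemma multiplicity_two_power_odd: "odd u \<Longrightarrow> multiplicity 2 (2 ^ i * u) = i" for u :: nat
  by (intro multiplicity_eqI) auto

lemma two_power_mult_odd_eq:
  fixes u v :: nat
  assumes "2 ^ i * u = 2 ^ j * v" "odd u" "odd v"
  shows "i = j \<and> u = v"
proof -
  have "i = j" using assms multiplicity_two_power_odd by metis
  then show ?thesis using assms by simp
qed

section \<open>Powers next to a power of 2\<close>

text \<open>Modulo 4 the exponent is odd; then \<open>b + 1\<close> carries all factors 2 of
  \<open>b ^ y + 1\<close>, which makes \<open>b ^ y + 1\<close> at most \<open>b + 1\<close>.
  \<open>F \<ge> 2\<close> excludes 1 + 1 = 2, where \<open>y\<close> is arbitrary.\<close>

lemma power_plus_one_eq_two_power: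
  fixes b y F :: nat
  assumes eq: "b ^ y + 1 = 2 ^ F" and F: "F \<ge> 2" and y: "y > 0"
  shows "y = 1"
proof (rule ccontr)
  assume "y \<noteq> 1"
  have four: "4 dvd b ^ y + 1"
    unfolding eq using le_imp_power_dvd[OF F, of "2::nat"] by simp
  then have "odd (b ^ y)" by presburger
  then have ob: "odd b" using y by simp
  have "odd y"
  proof
    assume "even y"
    then obtain k where k: "y = 2 * k" by blast
    obtain j where "b = 2 * j + 1" using ob by (elim oddE)
    then have "b\<^sup>2 = 4 * (j * j + j) + 1" by (simp add: power2_eq_square algebra_simps)
    then have "[b\<^sup>2 = 1] (mod 4)" by (simp add: cong_def)
    then have "[(b\<^sup>2) ^ k = 1 ^ k] (mod 4)" by (rule cong_pow)
    then have "[b ^ y = 1] (mod 4)" by (simp add: k power_mult)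
    then have "[b ^ y + 1 = 1 + 1] (mod 4)" by (rule cong_add) (rule cong_refl)
    then show False using four by (auto simp: cong_def)
  qed
  have "multiplicity 2 (b ^ y + 1 ^ y) = multiplicity 2 (b + 1) + multiplicity 2 y"
    by (rule lifting_the_exponent_plus) (use ob \<open>odd y\<close> in \<open>auto intro: odd_pos\<close>)
  then have "F = multiplicity 2 (b + 1)"
    using eq \<open>odd y\<close> by (simp add: not_dvd_imp_multiplicity_0 multiplicity_same_power)
  then have "2 ^ F dvd b + 1" using multiplicity_dvd by metis
  then have "b ^ y + 1 \<le> b + 1" using eq by (metis dvd_imp_le add_gr_0 zero_less_one)
  moreover have "b > 1"
  proof (rule ccontr)
    assume "\<not> b > 1"
    then have "b ^ y \<le> 1" using power_mono[of b 1 y] by simp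
    then show False using eq four dvd_imp_le[OF four] by simp
  qed
  moreover have "b ^ 1 < b ^ y" using \<open>b > 1\<close> \<open>y \<noteq> 1\<close> y by (intro power_strict_increasing) auto
  ultimately show False by simp
qed

text \<open>For odd \<open>z\<close> the number \<open>c - 1\<close> carries all factors 2 of
  \<open>c ^ z - 1\<close>. For even \<open>z\<close> a square is one more than a power of 2, and
  its two factors are powers of 2 at distance 2, hence 2 and 4; this is the exception 9 = 8 +
  1.\<close>

lemma power_eq_two_power_plus_one:
  fixes c z F :: nat
  assumes eq: "c ^ z = 2 ^ F + 1" and F: "F > 0" and z: "z > 0"
  shows "z = 1 \<or> z = 2 \<and> c = 3 \<and> F = 3"
proof (cases "even z")
  case False
  have oc: "odd c"
  proof
    assume "even c"
    then have "even (c ^ z)" using z by simp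
    then show False using eq F by simp
  qed
  have c1: "c > 1"
  proof (rule ccontr)
    assume "\<not> c > 1"
    then have "c ^ z \<le> 1" using power_mono[of c 1 z] by simp
    then show False using eq by simp
  qed
  have "z = 1"
  proof (rule ccontr)
    assume "z \<noteq> 1"
    have "multiplicity 2 (c ^ z - 1 ^ z) = multiplicity 2 (c - 1) + multiplicity 2 z"
      by (rule lifting_the_exponent_nat) (use oc c1 z False in auto)
    then have "F = multiplicity 2 (c - 1)"
      using eq False by (simp add: not_dvd_imp_multiplicity_0 multiplicity_same_power)
    then have "2 ^ F dvd c - 1" using multiplicity_dvd by metis
    then have "2 ^ F \<le> c - 1" using c1 by (intro dvd_imp_le) auto
    moreover have "c ^ 1 < c ^ z" using c1 \<open>z \<noteq> 1\<close> z by (intro power_strict_increasing) auto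
    ultimately show False using eq c1 by simp
  qed
  then show ?thesis by simp
next
  case True
  then obtain k where k: "z = 2 * k" "k > 0" using z by auto
  define u where "u = c ^ k"
  have u: "u\<^sup>2 = 2 ^ F + 1" using eq by (simp add: u_def k mult.commute flip: power_mult)
  have u2: "u > 1"
  proof (rule ccontr)
    assume "\<not> u > 1"
    then have "u\<^sup>2 \<le> 1" by (cases u) auto
    then show False using u by simp
  qed
  have "u\<^sup>2 - 1\<^sup>2 = (u + 1) * (u - 1)" by (rule square_diff_nat)
  then have "(u + 1) * (u - 1) = 2 ^ F" using u by simp
  then have "u + 1 dvd 2 ^ F" "u - 1 dvd 2 ^ F" by (metis dvd_triv_left, metis dvd_triv_right)
  then obtain i j where ij: "u + 1 = 2 ^ j" "u - 1 = 2 ^ i" using dvd_two_power_nat by meson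
  then have ij': "2 ^ j = 2 ^ i + (2::nat)" using u2 by simp
  have "i = 1"
  proof (rule ccontr)
    assume "i \<noteq> 1"
    then consider "i = 0" | "i \<ge> 2" by linarith
    then show False
    proof cases
      case 1
      then have "(2::nat) ^ j = 3" using ij' by simp
      then show False by (cases j) (auto simp: numeral_3_eq_3, presburger)
    next
      case 2
      then have "4 dvd (2::nat) ^ i" using le_imp_power_dvd[OF 2, of "2::nat"] by simp
      moreover have "j \<ge> 2"
      proof (rule ccontr)
        assume "\<not> j \<ge> 2"
        then have "j = 0 \<or> j = 1" by linarith
        then show False using ij' by auto
      qed
      then have "4 dvd (2::nat) ^ j" using le_imp_power_dvd[of 2 j "2::nat"] by simp
      ultimately show False unfolding ij' by presburger
    qed
  qed
  then have u3: "u = 3" using ij by simp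
  have "prime (c ^ k)" using u3 u_def by simp
  then have "k = 1" using prime_power_iff by blast
  moreover have "(2::nat) ^ F = 2 ^ 3" using u u3 by simp
  then have "F = 3" by (simp only: power_inject_exp)
  ultimately show ?thesis using k u3 u_def by simp
qed

text \<open>The order of 2 modulo \<open>2 ^ F - 1\<close> is \<open>F\<close>: once the exponent is
  reduced modulo \<open>F\<close>, the number \<open>2 ^ (n mod F) - 1\<close> is smaller than the
  modulus.\<close>

lemma two_power_cong_one_imp_dvd:
  fixes F n :: nat
  assumes F: "F > 0" and c: "[2 ^ n = (1::nat)] (mod (2 ^ F - 1))"
  shows "F dvd n"
proof -
  let ?M = "2 ^ F - 1 :: nat"
  have "[2 ^ F = 1] (mod ?M)" by (simp add: cong_altdef_nat)
  then have "[(2 ^ F) ^ (n div F) * 2 ^ (n mod F) = 1 ^ (n div F) * 2 ^ (n mod F)] (mod ?M)"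
    by (intro cong_mult cong_pow) auto
  moreover have "(2 ^ F) ^ (n div F) * 2 ^ (n mod F) = (2::nat) ^ n"
    unfolding power_mult[symmetric] power_add[symmetric] by simp
  ultimately have "[2 ^ n = 2 ^ (n mod F)] (mod ?M)" by simp
  then have "[2 ^ (n mod F) = 1] (mod ?M)" by (rule cong_trans[OF cong_sym c])
  then have dv: "?M dvd 2 ^ (n mod F) - 1" by (simp add: cong_altdef_nat)
  have "(2::nat) ^ (n mod F) < 2 ^ F" using F by simp
  moreover have ge: "(2::nat) ^ (n mod F) \<ge> 1" by simp
  ultimately have "(2::nat) ^ (n mod F) - 1 < ?M" by linarith
  then have "(2::nat) ^ (n mod F) - 1 = 0" using dv nat_dvd_not_less by blast
  then have "(2::nat) ^ (n mod F) = 1" using ge by linarith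
  then show ?thesis by (simp add: dvd_eq_mod_eq_0)
qed

text \<open>Modulo \<open>b = 2 ^ F - 1\<close> the base \<open>c = b + 2\<close> is 2, so the order
  of 2 gives \<open>z = F * t\<close>. For \<open>t = 1\<close> the divisor
  \<open>c - 1 = 2 ^ F\<close> forces \<open>l \<ge> F\<close>, and already
  \<open>2 ^ F * b ^ F \<ge> c ^ F\<close>. For larger \<open>t\<close> lifting shows that
  \<open>b ^ y\<close> divides \<open>(c ^ F - 1) * t\<close>, which is too small since
  \<open>y > F * t\<close>.\<close>

lemma two_power_neighbours_excluded:
  fixes F l y z :: nat
  assumes F: "F \<ge> 2" and yz: "z < y" and z: "z > 0"
    and eq: "1 + 2 ^ l * (2 ^ F - 1) ^ y = (2 ^ F + 1 :: nat) ^ z"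
  shows False
proof -
  define b c where "b = 2 ^ F - (1::nat)" and "c = 2 ^ F + (1::nat)"
  have "(2::nat) ^ 2 \<le> 2 ^ F" using F by (rule power_increasing) simp
  then have b3: "b \<ge> 3" by (simp add: b_def)
  have F2: "2 ^ F = b + 1" by (simp add: b_def)
  have cb: "c = b + 2" by (simp add: c_def F2)
  have eq': "c ^ z = 1 + 2 ^ l * b ^ y" using eq by (simp add: b_def c_def)
  have ob: "odd b"
  proof -
    have "even ((2::nat) ^ F)" using F by simp
    then show ?thesis using F2 by simp
  qed
  have c2: "[c = 2] (mod b)" by (simp add: cb cong_def del: add_2_eq_Suc')
  have "b dvd b ^ y" using yz by (simp add: dvd_power)
  then have "[1 + 2 ^ l * b ^ y = 1 + 0] (mod b)"
    by (intro cong_add cong_refl) (simp add: cong_0_iff)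
  then have "[c ^ z = 1] (mod b)" using eq' by simp
  then have "[2 ^ z = 1] (mod b)" by (rule cong_trans[OF cong_sym[OF cong_pow[OF c2, of z]]])
  then have "F dvd z" using two_power_cong_one_imp_dvd[of F z] F by (simp add: b_def)
  then obtain t where t: "z = F * t" by blast
  have t0: "t > 0" using z t by simp
  have cF: "c ^ F \<le> 2 ^ F * b ^ F"
  proof -
    have "c ^ F \<le> (2 * b) ^ F" using b3 cb by (intro power_mono) auto
    then show ?thesis by (simp add: power_mult_distrib)
  qed
  show False
  proof (cases "t = 1")
    case True
    have "c - 1 dvd c ^ z - 1 ^ z" by (rule diff_dvd_power_diff_nat)
    then have "2 ^ F dvd 2 ^ l * b ^ y" using eq' by (simp add: c_def)
    moreover have "coprime (2 ^ F) (b ^ y)" using ob by simp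
    ultimately have "(2::nat) ^ F dvd 2 ^ l" using coprime_dvd_mult_left_iff by blast
    then have "(2::nat) ^ F \<le> 2 ^ l" by (intro dvd_imp_le) auto
    moreover have "b ^ F \<le> b ^ y" using b3 yz t True by (intro power_increasing) auto
    ultimately have "2 ^ F * b ^ F \<le> 2 ^ l * b ^ y" by (intro mult_mono) auto
    then show False using cF eq' t True by simp
  next
    case False
    then have t2: "t \<ge> 2" using t0 by simp
    define X where "X = c ^ F"
    have "[c ^ F = 2 ^ F] (mod b)" by (rule cong_pow[OF c2])
    moreover have "[2 ^ F = 1] (mod b)" by (simp add: F2 cong_altdef_nat)
    ultimately have "[X = 1] (mod b)" unfolding X_def by (rule cong_trans)
    moreover have X1: "X > 1" unfolding X_def using cb b3 F by (intro one_less_power) auto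
    ultimately have bX: "b dvd X - 1" by (simp add: cong_altdef_nat)
    have "b ^ y dvd (X - 1) * t"
    proof (rule multiplicity_le_imp_dvd)
      show "b ^ y \<noteq> 0" using b3 by simp
      fix q :: nat assume q: "prime q"
      show "multiplicity q (b ^ y) \<le> multiplicity q ((X - 1) * t)"
      proof (cases "q dvd b")
        case True
        have "q \<noteq> 2" using True ob by auto
        have "multiplicity q (X ^ t - 1 ^ t) = multiplicity q (X - 1) + multiplicity q t"
          by (rule lifting_the_exponent_nat)
            (use q True bX X1 t0 \<open>q \<noteq> 2\<close> dvd_trans in \<open>auto dest: prime_gt_1_nat\<close>)
        moreover have "multiplicity q ((X - 1) * t) = multiplicity q (X - 1) + multiplicity q t"
          using q X1 t0 by (intro prime_elem_multiplicity_mult_distrib) auto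
        moreover have "X ^ t - 1 ^ t = 2 ^ l * b ^ y"
          using eq' by (simp add: X_def t flip: power_mult)
        moreover have "multiplicity q (b ^ y) \<le> multiplicity q (2 ^ l * b ^ y)"
          using b3 by (intro dvd_imp_multiplicity_le) auto
        ultimately show ?thesis by simp
      next
        case False
        then have "\<not> q dvd b ^ y" using q prime_dvd_power by blast
        then show ?thesis by (simp add: not_dvd_imp_multiplicity_0)
      qed
    qed
    then have "b ^ y \<le> (X - 1) * t" using X1 t0 by (intro dvd_imp_le) auto
    also have "\<dots> < X * t" using X1 t0 by simp
    also have "\<dots> \<le> 2 ^ F * b ^ F * t" using cF by (simp add: X_def)
    also have "\<dots> \<le> b\<^sup>2 * b ^ F * t"
    proof -
      have "b + 1 \<le> 3 * b" using b3 by simp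
      also have "\<dots> \<le> b * b" using b3 by (rule mult_le_mono1)
      finally have "2 ^ F \<le> b\<^sup>2" by (simp add: F2 power2_eq_square)
      then show ?thesis by (intro mult_right_mono) auto
    qed
    also have "\<dots> = b ^ (F + 2) * t" by (simp add: power_add power2_eq_square)
    finally have lt: "b ^ y < b ^ (F + 2) * t" .
    \<comment> \<open>From \<open>y > F * t\<close> the exponent \<open>y\<close> exceeds
      \<open>F + 2\<close> by at least \<open>t - 1 = v + 1\<close>, so the bound shrinks to
      \<open>b ^ (t - 1) < t\<close>.\<close>
    obtain v where v: "t = v + 2" using t2 by (metis add.commute le_Suc_ex)
    have "F + 2 + (v + 1) \<le> y"
    proof -
      have "2 * (v + 1) \<le> F * (v + 1)" using F by (rule mult_le_mono1)
      then show ?thesis using yz by (simp add: t v)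
    qed
    then have "b ^ (F + 2) * b ^ (v + 1) \<le> b ^ y"
      unfolding power_add[symmetric] by (rule power_increasing) (use b3 in simp)
    then have "b ^ (F + 2) * b ^ (v + 1) < b ^ (F + 2) * t" using lt by linarith
    then have "b ^ (v + 1) < t" by (simp only: mult_less_cancel1)
    moreover have "v + 1 < 2 ^ (v + 1)" by (rule less_exp)
    moreover have "(2::nat) ^ (v + 1) \<le> b ^ (v + 1)" using b3 by (intro power_mono) auto
    ultimately show False using v by linarith
  qed
qed

text \<open>Modulo 7 the order of 3 is 6, so 6 divides \<open>z\<close>. Since 3^6 - 1 = 8 * 7 * 13,
  this brings in the prime 13, which does not divide \<open>2 ^ l * 7 ^ y\<close>.\<close>

lemma seven_three_excluded:
  fixes l y z :: nat
  assumes y: "y > 0" and z: "z > 0" and eq: "1 + 2 ^ l * 7 ^ y = (3::nat) ^ z"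
  shows False
proof -
  have "7 dvd (7::nat) ^ y" using y by (simp add: dvd_power)
  then have "[1 + 2 ^ l * 7 ^ y = 1 + (0::nat)] (mod 7)"
    by (intro cong_add cong_refl) (simp add: cong_0_iff)
  then have "[3 ^ z = (1::nat)] (mod 7)" using eq by simp
  moreover define k i where "k = z div 6" and "i = z mod 6"
  have zz: "(3::nat) ^ z = 729 ^ k * 3 ^ i"
  proof -
    have "(3::nat) ^ z = 3 ^ (6 * k + i)" by (simp add: k_def i_def)
    then show ?thesis by (simp add: power_add power_mult)
  qed
  moreover have "[729 ^ k * 3 ^ i = 1 ^ k * (3::nat) ^ i] (mod 7)"
    by (intro cong_mult cong_pow cong_refl) (simp add: cong_def)
  ultimately have "[3 ^ i = (1::nat)] (mod 7)" by (metis cong_sym cong_trans mult_1 power_one)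
  moreover have "i < 6" by (simp add: i_def)
  then have "i = 0 \<or> i = 1 \<or> i = 2 \<or> i = 3 \<or> i = 4 \<or> i = 5" by linarith
  ultimately have i0: "i = 0" by (auto simp: cong_def)
  have "[729 ^ k = (1::nat) ^ k] (mod 13)" by (intro cong_pow) (simp add: cong_def)
  then have "[3 ^ z = (1::nat)] (mod 13)" using zz i0 by simp
  then have "[1 + 2 ^ l * 7 ^ y = 1 + (0::nat)] (mod 13)" using eq by simp
  then have "[2 ^ l * 7 ^ y = (0::nat)] (mod 13)" by (simp only: cong_add_lcancel_nat)
  then have d: "(13::nat) dvd 2 ^ l * 7 ^ y" by (simp add: cong_0_iff)
  have p13: "prime (13::nat)" by simp
  have "(13::nat) dvd 2 \<or> (13::nat) dvd 7"
    using d p13 prime_dvd_mult_iff prime_dvd_power by blast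
  then show False by simp
qed

text \<open>Here \<open>a\<close> is a power of 2, so dividing a Type B solution by
  \<open>a ^ x2\<close> leaves \<open>1 + 2 ^ l * b1 ^ y2 = c1 ^ z2\<close> for the odd parts of
  \<open>b\<close> and \<open>c\<close>. For \<open>F = 1\<close> also \<open>b\<close> is a power
  of 2, and the Type B solutions are those of the pair with the two terms exchanged; hence the
  unordered sets in the conclusion. For \<open>F \<ge> 2\<close> there are none:
  \<open>y = 1\<close>, and either \<open>z = 1\<close> or \<open>b1 = 7\<close>,
  \<open>c1 = 3\<close>.\<close>

lemma shape_i_type_B:
  assumes shape: "shape_i a b c (x, y, z) (x', y', z')"
    and abc: "a > 1" "b > 1" "c > 1" and pos: "x > 0" "y > 0" "z > 0"
    and sol: "is_solution (a, b, c) (x2, y2, z2)"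
    and B: "type_B_prime (a, b, c) 2 (x2, y2, z2)"
  shows "{a ^ x2, b ^ y2} = {a ^ x, b ^ y} \<or> {a ^ x2, b ^ y2} = {a ^ x', b ^ y'}"
proof -
  obtain F e where *: "F > 0" "e > 0" "y' = 2 * y" "z' = 2 * z"
     "b ^ y = 2 ^ e * (2 ^ F - 1)" "c ^ z = 2 ^ e * (2 ^ F + 1)"
     "a ^ x = 2 ^ (e + 1)" "a ^ x' = 2 ^ (2 * e + F + 2)"
    using shape unfolding shape_i_def by auto
  obtain \<alpha> where \<alpha>: "a = 2 ^ \<alpha>" using power_of_prime_base[OF _ *(7)] pos abc by auto
  define \<beta> \<gamma> where "\<beta> = multiplicity 2 b" and "\<gamma> = multiplicity 2 c"
  obtain b1 where b1: "b = 2 ^ \<beta> * b1" "odd b1"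
    using multiplicity_decompose'[of b 2] abc unfolding \<beta>_def by auto
  obtain c1 where c1: "c = 2 ^ \<gamma> * c1" "odd c1"
    using multiplicity_decompose'[of c 2] abc unfolding \<gamma>_def by auto
  have pow: "even ((2::nat) ^ F)" "(2::nat) ^ F \<ge> 1" using *(1) by simp_all
  have "\<beta> * y = e \<and> b1 ^ y = 2 ^ F - 1"
    by (rule two_power_mult_odd_eq) (use *(5) b1 pow in \<open>auto simp: power_mult_distrib power_mult\<close>)
  then have b: "\<beta> * y = e" "b1 ^ y = 2 ^ F - 1" by auto
  have "\<gamma> * z = e \<and> c1 ^ z = 2 ^ F + 1"
    by (rule two_power_mult_odd_eq) (use *(6) c1 pow in \<open>auto simp: power_mult_distrib power_mult\<close>)
  then have c: "\<gamma> * z = e" "c1 ^ z = 2 ^ F + 1" by auto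
  have m: "\<alpha> * x2 = \<gamma> * z2" "\<gamma> * z2 < \<beta> * y2"
    using B by (auto simp: \<alpha> \<beta>_def \<gamma>_def multiplicity_same_power)
  define l where "l = \<beta> * y2 - \<gamma> * z2"
  have l: "l > 0" "\<beta> * y2 = \<gamma> * z2 + l" using m by (auto simp: l_def)
  have ax2: "a ^ x2 = 2 ^ (\<gamma> * z2)" by (simp add: \<alpha> m(1) flip: power_mult)
  have by2: "b ^ y2 = 2 ^ (\<gamma> * z2) * (2 ^ l * b1 ^ y2)"
    by (simp add: b1(1) power_mult_distrib l(2) power_add flip: power_mult)
  have pos2: "x2 > 0" "y2 > 0" "z2 > 0" and e2: "a ^ x2 + b ^ y2 = c ^ z2" using sol by auto
  have "2 ^ (\<gamma> * z2) * (1 + 2 ^ l * b1 ^ y2) = 2 ^ (\<gamma> * z2) * c1 ^ z2"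
    using e2 unfolding ax2 by2 by (simp add: c1(1) power_mult_distrib algebra_simps flip: power_mult)
  then have eq: "1 + 2 ^ l * b1 ^ y2 = c1 ^ z2"
    by (metis mult_left_cancel power_not_zero zero_neq_numeral)
  show ?thesis
  proof (cases "F = 1")
    case True
    then have b11: "b1 = 1" using b(2) pos by simp
    have "c1 ^ z = 3" using c(2) True by simp
    then have "prime (c1 ^ z)" by simp
    then have z1: "z = 1" using prime_power_iff by blast
    then have c3: "c1 = 3" using c(2) True by simp
    have \<gamma>: "\<gamma> = e" using c z1 by simp
    have e3: "3 ^ z2 = 2 ^ l + (1::nat)" using eq b11 c3 by simp
    have "z2 = 1 \<or> z2 = 2 \<and> l = 3"
      using power_eq_two_power_plus_one[OF e3] l pos2 by auto
    then show ?thesis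
    proof
      assume z2: "z2 = 1"
      then have "l = 1"
      proof -
        have "(2::nat) ^ l = 2 ^ 1" using e3 z2 by simp
        then show ?thesis by (simp only: power_inject_exp)
      qed
      then have "a ^ x2 = b ^ y" "b ^ y2 = a ^ x"
        using ax2 by2 z2 \<gamma> * True b11 by simp_all
      then show ?thesis by (simp add: insert_commute)
    next
      assume z2: "z2 = 2 \<and> l = 3"
      have "b ^ y' = (b ^ y)\<^sup>2" using *(3) by (simp add: mult.commute flip: power_mult)
      then have "b ^ y' = 2 ^ (2 * e)" using *(5) True by (simp add: mult.commute flip: power_mult)
      then have "a ^ x2 = b ^ y'" using ax2 z2 \<gamma> by (simp add: mult.commute)
      moreover have "b ^ y2 = a ^ x'"
        using by2 z2 \<gamma> *(8) True b11 by (simp add: mult.commute power_add)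
      ultimately show ?thesis by (simp add: insert_commute)
    qed
  next
    case False
    then have F2: "F \<ge> 2" using *(1) by simp
    have "b1 ^ y + 1 = 2 ^ F" using b(2) by simp
    then have y1: "y = 1" using power_plus_one_eq_two_power F2 pos by blast
    have "z = 1 \<or> z = 2 \<and> c1 = 3 \<and> F = 3"
      using power_eq_two_power_plus_one[OF c(2)] *(1) pos by blast
    then have False
    proof
      assume z1: "z = 1"
      \<comment> \<open>With equal valuations of \<open>b\<close> and \<open>c\<close>, Type B reads
        \<open>z2 < y2\<close>, the inequality needed for the size bound.\<close>
      have "\<beta> = \<gamma>" using b c y1 z1 by simp
      then have "z2 < y2" using m(2) by simp
      then show False
        using two_power_neighbours_excluded[OF F2 _ pos2(3), of y2 l] eq b(2) c(2) y1 z1 by simp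
    next
      assume z2': "z = 2 \<and> c1 = 3 \<and> F = 3"
      then have "b1 = 7" using b(2) y1 by simp
      then show False using seven_three_excluded[OF pos2(2,3), of l] eq z2' by simp
    qed
    then show ?thesis ..
  qed
qed

section \<open>Types of solutions at the common primes\<close>

lemma multiplicity_add_cases:
  fixes u v p :: nat
  assumes p: "prime p" and uv: "u > 0" "v > 0"
  shows "multiplicity p (u + v) = multiplicity p v \<and> multiplicity p v < multiplicity p u \<or>
    multiplicity p (u + v) = multiplicity p u \<and> multiplicity p u < multiplicity p v \<or>
    multiplicity p u = multiplicity p v \<and> multiplicity p u \<le> multiplicity p (u + v)"
proof -
  consider "multiplicity p v < multiplicity p u" | "multiplicity p u < multiplicity p v"
    | "multiplicity p u = multiplicity p v" by linarith
  then show ?thesis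
  proof cases
    case 1
    then show ?thesis using multiplicity_sum_lt[of p v u] uv by (simp add: add.commute)
  next
    case 2
    then show ?thesis using multiplicity_sum_lt[of p u v] uv by simp
  next
    case 3
    have "p ^ multiplicity p u dvd u + v"
      by (intro dvd_add) (simp_all add: multiplicity_dvd 3, metis 3 multiplicity_dvd)
    then have "multiplicity p u \<le> multiplicity p (u + v)"
      using p uv by (intro multiplicity_geI) (auto dest: not_prime_unit)
    then show ?thesis using 3 by simp
  qed
qed

text \<open>The alternatives are Type A, Type B, and a third one that includes equality of all three
  valuations.\<close>

lemma solution_valuations:
  fixes a b c p :: nat
  assumes p: "prime p" and abc: "a > 1" "b > 1" "c > 1" and s: "is_solution (a, b, c) (x, y, z)"
  shows "multiplicity p c * z = multiplicity p b * y \<and> multiplicity p b * y < multiplicity p a * x \<or>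
    multiplicity p c * z = multiplicity p a * x \<and> multiplicity p a * x < multiplicity p b * y \<or>
    multiplicity p a * x = multiplicity p b * y \<and> multiplicity p a * x \<le> multiplicity p c * z"
proof -
  have "multiplicity p (u ^ n) = multiplicity p u * n" if "u > 1" for u n :: nat
    using p that by (simp add: prime_elem_multiplicity_power_distrib)
  then show ?thesis
    using multiplicity_add_cases[OF p, of "a ^ x" "b ^ y"] s abc by simp
qed

lemma common_prime_dvd_third:
  fixes a b c p :: nat
  assumes "prime p" "p dvd a" "p dvd b" "is_solution (a, b, c) (x, y, z)"
  shows "p dvd c"
proof -
  have "p dvd a ^ x" "p dvd b ^ y" using assms by (simp_all add: prime_dvd_power_iff)
  then have "p dvd a ^ x + b ^ y" by (rule dvd_add)
  then have "p dvd c ^ z" using assms(4) by simp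
  then show ?thesis using assms(1) prime_dvd_power by blast
qed

lemma proportional_of_equal_valuations:
  fixes \<beta> \<gamma> :: nat
  assumes "\<beta> * y1 = \<gamma> * z1" "\<beta> * y2 = \<gamma> * z2" "\<beta> > 0" "\<gamma> > 0"
  shows "y1 * z2 = y2 * z1"
proof -
  have "(\<beta> * \<gamma>) * (y1 * z2) = (\<beta> * y1) * (\<gamma> * z2)" by simp
  also have "\<dots> = (\<gamma> * z1) * (\<beta> * y2)" by (simp only: assms)
  also have "\<dots> = (\<beta> * \<gamma>) * (y2 * z1)" by simp
  finally show ?thesis using assms by simp
qed

text \<open>If all three valuations agree in one solution, any equality in the other is shared and
  gives a proportionality. If \<open>c ^ z\<close> is strictly the largest in one solution, it is
  not so in the other, where it is then minimal, and the size comparison applies. Two solutions of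
  the same type would again be proportional.\<close>

lemma not_proportional_types:
  fixes a b c p :: nat
  assumes abc: "a > 1" "b > 1" "c > 1" and p: "prime p" "p dvd a" "p dvd b"
    and s1: "is_solution (a, b, c) (x1, y1, z1)" and s2: "is_solution (a, b, c) (x2, y2, z2)"
    and ne: "x1 * y2 \<noteq> x2 * y1" "y1 * z2 \<noteq> y2 * z1" "x1 * z2 \<noteq> x2 * z1"
  shows "type_A_prime (a, b, c) p (x1, y1, z1) \<and> type_B_prime (a, b, c) p (x2, y2, z2) \<or>
    type_B_prime (a, b, c) p (x1, y1, z1) \<and> type_A_prime (a, b, c) p (x2, y2, z2)"
proof -
  have pc: "p dvd c" using common_prime_dvd_third p s1 by blast
  define \<alpha> \<beta> \<gamma> where d: "\<alpha> = multiplicity p a" "\<beta> = multiplicity p b" "\<gamma> = multiplicity p c"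
  have pos: "\<alpha> > 0" "\<beta> > 0" "\<gamma> > 0"
    using p pc abc by (simp_all add: d prime_multiplicity_gt_zero_iff)
  note v1 = solution_valuations[OF p(1) abc s1, folded d]
  note v2 = solution_valuations[OF p(1) abc s2, folded d]
  have xy: "\<not> (\<alpha> * x1 = \<beta> * y1 \<and> \<alpha> * x2 = \<beta> * y2)"
    using proportional_of_equal_valuations[of \<alpha> x1 \<beta> y1 x2 y2] pos ne by blast
  have yz: "\<not> (\<beta> * y1 = \<gamma> * z1 \<and> \<beta> * y2 = \<gamma> * z2)"
    using proportional_of_equal_valuations[of \<beta> y1 \<gamma> z1 y2 z2] pos ne by blast
  have xz: "\<not> (\<alpha> * x1 = \<gamma> * z1 \<and> \<alpha> * x2 = \<gamma> * z2)"
    using proportional_of_equal_valuations[of \<alpha> x1 \<gamma> z1 x2 z2] pos ne by blast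
  have C12: "\<not> (\<gamma> * z1 \<le> \<alpha> * x1 \<and> \<gamma> * z1 \<le> \<beta> * y1 \<and> \<alpha> * x2 = \<beta> * y2 \<and> \<beta> * y2 < \<gamma> * z2)"
    using type_C_excluded[OF p(1) pc abc, of x1 y1 z1 x2 y2 z2, folded d] s1 s2 pos by auto
  have C21: "\<not> (\<gamma> * z2 \<le> \<alpha> * x2 \<and> \<gamma> * z2 \<le> \<beta> * y2 \<and> \<alpha> * x1 = \<beta> * y1 \<and> \<beta> * y1 < \<gamma> * z1)"
    using type_C_excluded[OF p(1) pc abc, of x2 y2 z2 x1 y1 z1, folded d] s1 s2 pos by auto
  \<comment> \<open>Replacing the products by six variables leaves a finite case check over linear
    conditions.\<close>
  have combine: "Z1 = Y1 \<and> Y1 < X1 \<and> Z2 = X2 \<and> X2 < Y2 \<or> Z2 = Y2 \<and> Y2 < X2 \<and> Z1 = X1 \<and> X1 < Y1"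
    if "Z1 = Y1 \<and> Y1 < X1 \<or> Z1 = X1 \<and> X1 < Y1 \<or> X1 = Y1 \<and> X1 \<le> Z1"
      "Z2 = Y2 \<and> Y2 < X2 \<or> Z2 = X2 \<and> X2 < Y2 \<or> X2 = Y2 \<and> X2 \<le> Z2"
      "\<not> (X1 = Y1 \<and> X2 = Y2)" "\<not> (Y1 = Z1 \<and> Y2 = Z2)" "\<not> (X1 = Z1 \<and> X2 = Z2)"
      "\<not> (Z1 \<le> X1 \<and> Z1 \<le> Y1 \<and> X2 = Y2 \<and> Y2 < Z2)"
      "\<not> (Z2 \<le> X2 \<and> Z2 \<le> Y2 \<and> X1 = Y1 \<and> Y1 < Z1)"
    for X1 Y1 Z1 X2 Y2 Z2 :: nat
    using that by (elim disjE) auto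
  have "\<gamma> * z1 = \<beta> * y1 \<and> \<beta> * y1 < \<alpha> * x1 \<and> \<gamma> * z2 = \<alpha> * x2 \<and> \<alpha> * x2 < \<beta> * y2 \<or>
      \<gamma> * z2 = \<beta> * y2 \<and> \<beta> * y2 < \<alpha> * x2 \<and> \<gamma> * z1 = \<alpha> * x1 \<and> \<alpha> * x1 < \<beta> * y1"
    by (rule combine[OF v1 v2 xy yz xz C12 C21])
  then show ?thesis using p pc by (auto simp: d)
qed

section \<open>Exchanging \<open>a\<close> and \<open>b\<close>\<close>

lemma is_solution_swap: "is_solution (b, a, c) (y, x, z) \<longleftrightarrow> is_solution (a, b, c) (x, y, z)"
  by (auto simp: add.commute)

lemma corresponds_swap: "corresponds ABC S (b, a, c) (y, x, z) \<longleftrightarrow> corresponds ABC S (a, b, c) (x, y, z)"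
  by (cases ABC, cases S) (auto simp: insert_commute)

text \<open>Correspondence sees only the unordered pair of terms, so membership survives the
  exchange although the families are written asymmetrically. Proportional \<open>x\<close>,
  \<open>z\<close> thereby reduce to proportional \<open>y\<close>, \<open>z\<close>.\<close>

lemma in_family_swap:
  "in_family F (b, a, c) (y1, x1, z1) (y2, x2, z2) \<longleftrightarrow> in_family F (a, b, c) (x1, y1, z1) (x2, y2, z2)"
proof -
  have "(y1, x1, z1) \<noteq> (y2, x2, z2) \<longleftrightarrow> (x1, y1, z1) \<noteq> (x2, y2, z2)" by auto
  then show ?thesis by (simp only: in_family_def corresponds_swap is_solution_swap)
qed

lemma yz_proportional_family:
  fixes a b c :: nat
  assumes abc: "a > 1" "b > 1" "c > 1" and p: "prime p" "p dvd b" "p dvd c"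
    and s1: "is_solution (a, b, c) (x1, y1, z1)" and s2: "is_solution (a, b, c) (x2, y2, z2)"
    and ne: "(x1, y1, z1) \<noteq> (x2, y2, z2)" and pr: "y1 * z2 = y2 * z1"
  shows "in_family family_i (a, b, c) (x1, y1, z1) (x2, y2, z2) \<or>
    in_family family_iii (a, b, c) (x1, y1, z1) (x2, y2, z2) \<or>
    in_family family_iv (a, b, c) (x1, y1, z1) (x2, y2, z2)"
proof -
  obtain S S' where S: "(S, S') = ((x1, y1, z1), (x2, y2, z2)) \<or> (S, S') = ((x2, y2, z2), (x1, y1, z1))"
    "shape_i a b c S S' \<or> shape_iii a b c S S' \<or> shape_iv a b c S S'"
    by (rule yz_proportional[OF abc p s1 s2 ne pr])
  have fam: "in_family F (a, b, c) (x1, y1, z1) (x2, y2, z2)"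
    if "(ABC, S1, S2) \<in> F" "corresponds ABC S1 (a, b, c) S" "corresponds ABC S2 (a, b, c) S'"
    for F ABC S1 S2
    unfolding in_family_def using that S(1) s1 s2 ne by blast
  have "fst S > 0" using S(1) s1 s2 by auto
  then show ?thesis
    using S(2) shape_i_family shape_iii_family shape_iv_family abc(1) fam by metis
qed

section \<open>A further solution next to families (iii) and (iv)\<close>

text \<open>Up to a factor 2, the term \<open>a ^ x\<close> of the first solution divides
  \<open>b ^ y\<close> and \<open>c ^ z\<close>. At an odd prime of \<open>a\<close> that solution
  therefore cannot be Type A, which later identifies it within a pair.\<close>

lemma shape_iii_iv_base:
  assumes shape: "shape_iii a b c (x, y, z) S' \<or> shape_iv a b c (x, y, z) S'"
    and abc: "a > 1" "b > 1" "c > 1" and pos: "x > 0" "y > 0" "z > 0"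
  obtains q where "prime q" "odd q" "q dvd a" "q dvd b" "q dvd c" "multiplicity q a * x \<le> multiplicity q b * y"
proof -
  have "\<exists>q h. prime q \<and> odd q \<and> q dvd a \<and> h dvd b ^ y \<and> h dvd c ^ z \<and> (a ^ x = h \<or> a ^ x = 2 * h)"
    using shape
  proof
    assume "shape_iii a b c (x, y, z) S'"
    then have *: "a ^ x dvd b ^ y" "a ^ x dvd c ^ z" "odd a" unfolding shape_iii_def by (auto split: prod.splits)
    obtain q where "prime q" "q dvd a" using abc prime_factor_nat[of a] by auto
    moreover have "odd q" using * \<open>q dvd a\<close> dvd_trans by blast
    ultimately show ?thesis using * by blast
  next
    assume "shape_iv a b c (x, y, z) S'"
    then obtain h s q where "2 * h = a ^ x" "b ^ y = h * s" "c ^ z = h * (s + 2)" "prime q" "odd q" "q dvd a"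
      unfolding shape_iv_def by (auto split: prod.splits)
    then show ?thesis by (metis dvd_triv_left)
  qed
  then obtain q h where q: "prime q" "odd q" "q dvd a" and h: "h dvd b ^ y" "h dvd c ^ z" "a ^ x = h \<or> a ^ x = 2 * h"
    by blast
  have nq2: "\<not> q dvd 2" using q by (metis primes_dvd_imp_eq two_is_prime_nat even_numeral)
  moreover have "h > 0" using h(3) abc by (metis gr0I mult_0_right not_one_less_zero power_eq_0_iff)
  ultimately have mh: "multiplicity q (a ^ x) = multiplicity q h"
    using h(3) q(1)
    by (auto simp: prime_elem_multiplicity_mult_distrib not_dvd_imp_multiplicity_0)
  have h0: "b ^ y \<noteq> 0" using abc by simp
  have "multiplicity q (a ^ x) \<le> multiplicity q (b ^ y)"
    unfolding mh by (rule dvd_imp_multiplicity_le[OF h(1) h0])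
  then have le: "multiplicity q a * x \<le> multiplicity q b * y"
    using q(1) abc by (simp add: prime_elem_multiplicity_power_distrib mult.commute)
  have "q dvd a ^ x" using q(1,3) pos(1) prime_dvd_power_iff by blast
  then have "q dvd h \<or> q dvd 2 * h" using h(3) by auto
  then have "q dvd h" using nq2 q(1) by (auto simp: prime_dvd_mult_iff)
  then have "q dvd b ^ y" "q dvd c ^ z" using h(1,2) by (auto intro: dvd_trans)
  then have "q dvd b" "q dvd c" using q(1) prime_dvd_power by auto
  then show ?thesis using that q le by blast
qed

text \<open>With g = gcd k l, every prime of \<open>2 ^ l - 1\<close> already divides
  \<open>2 ^ g - 1\<close>. Regarded as a power of \<open>2 ^ g\<close> minus 1, it has no new
  prime, and an exponent above 1 would require \<open>2 ^ g\<close> to be odd.\<close>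

lemma mersenne_prime_divisors:
  fixes k l :: nat
  assumes k: "k > 0" and l: "l > 0"
    and pr: "\<And>q. prime q \<Longrightarrow> q dvd 2 ^ l - 1 \<Longrightarrow> q dvd 2 ^ k - (1::nat)"
  shows "l dvd k"
proof -
  define g where "g = gcd k l"
  obtain n where n: "l = g * n" using g_def by (metis dvdE gcd_dvd2)
  have g0: "g > 0" and n0: "n > 0" using l n by (auto intro: gr0I)
  have "n = 1"
  proof (rule ccontr)
    assume "n \<noteq> 1"
    then have n1: "n > 1" using n0 by simp
    have X: "(1::nat) < 2 ^ g" using one_less_power[of "2::nat" g] g0 by simp
    have "q dvd 2 ^ g - 1" if q: "prime q" "q dvd (2 ^ g) ^ n - 1 ^ n" for q :: nat
    proof -
      have ql: "q dvd 2 ^ l - 1" using q by (simp add: n power_mult)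
      then have "q dvd 2 ^ k - 1 ^ k" "q dvd 2 ^ l - 1 ^ l" using pr q by auto
      moreover have "\<not> q dvd 1" using q by (auto dest: prime_gt_1_nat)
      ultimately have "q dvd 2 ^ gcd k l - 1 ^ gcd k l"
        using prime_dvd_power_diff_gcd[of q 1 k 2 l] q(1) k by simp
      then show ?thesis by (simp add: g_def)
    qed
    then have "odd ((2::nat) ^ g)"
      using prime_divisors_of_power_diff[OF X _ _ n1] by auto
    then show False using g0 by simp
  qed
  then have "l = gcd k l" using n g_def by simp
  then show ?thesis by (metis gcd_dvd1)
qed

text \<open>With \<open>k = 2 * j\<close> the left side minus 1 is \<open>9 ^ j - 1\<close> and has
  \<open>3 + multiplicity 2 j\<close> factors 2, while the right side provides at least
  \<open>2 * j + 1\<close>. This leaves \<open>j = 1\<close> and \<open>b ^ w = 2\<close>, against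
  the odd prime \<open>q\<close>.\<close>

lemma three_power_excluded:
  fixes b w k :: nat
  assumes k: "even k" "k > 0" and eq: "3 ^ k = 1 + 2 ^ k * b ^ w" and b: "even b" and w: "w > 0"
    and q: "prime q" "odd q" "q dvd b"
  shows False
proof -
  obtain j where j: "k = 2 * j" "j > 0" using k by auto
  have "multiplicity 2 ((9::nat) ^ j - 1 ^ j) = multiplicity 2 (9 - 1 :: nat) + multiplicity 2 j"
    using j by (intro lifting_the_exponent_nat) auto
  moreover have "multiplicity 2 (8::nat) = 3"
    using multiplicity_same_power[of "2::nat" 3] by simp
  moreover have "(9::nat) ^ j - 1 ^ j = 2 ^ k * b ^ w" using eq by (simp add: j power_mult)
  ultimately have m: "multiplicity 2 (2 ^ k * b ^ w) = 3 + multiplicity 2 j" by simp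
  have "even (b ^ w)" using b w by simp
  then have "2 ^ k * 2 dvd 2 ^ k * b ^ w" by simp
  then have d: "2 ^ (k + 1) dvd 2 ^ k * b ^ w" by (simp add: mult.commute)
  have "2 ^ k * b ^ w \<noteq> 0"
  proof
    assume "2 ^ k * b ^ w = 0"
    then have "(3::nat) ^ k = 1" using eq by simp
    then show False using k by simp
  qed
  then have "k + 1 \<le> multiplicity 2 (2 ^ k * b ^ w)" using d by (intro multiplicity_geI) auto
  then have "k + 1 \<le> 3 + multiplicity 2 j" using m by simp
  then have "2 * j \<le> 2 + multiplicity 2 j" using j by simp
  then have "j = 1" using multiplicity_nat_less[of 2 j] j by simp
  then have "b ^ w = 2" using eq by (simp add: j)
  then have "q dvd 2" using q(3) w by (metis dvd_power dvd_trans)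
  then show False using q by (metis primes_dvd_imp_eq two_is_prime_nat even_numeral)
qed

text \<open>Eliminating \<open>a ^ x\<close> and \<open>b ^ y\<close> gives
  \<open>s' * s = 2\<close> with \<open>s'\<close> odd. So \<open>s' = 1\<close>, and the defining
  equation of shape (iv) becomes one for \<open>3 ^ k\<close>.\<close>

lemma shapes_iii_iv_excluded:
  assumes s3: "shape_iii a b c (x, y, z) (x1, y1, z1)" and s4: "shape_iv b a c (y, x, z) (y2, x2, z2)"
    and ab: "a > 1" "b > 1"
  shows False
proof -
  obtain s where s: "b ^ y = a ^ x * s"
    using s3 unfolding shape_iii_def by auto
  obtain k s' h q where k: "k > 1" "even k" "odd s'" "2 * h = b ^ y" "a ^ x = h * s'" "k * y < y2"
     "(s' + 2) ^ k = s' ^ k + 2 ^ k * b ^ (y2 - k * y)" "prime q" "odd q" "q dvd b"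
    using s4 unfolding shape_iv_def by auto
  have h: "h > 0" using k(5) ab by (metis gr0I mult_0 not_one_less_zero power_eq_0_iff)
  have "h * 2 = h * (s' * s)" using s k(4,5) by (simp add: mult.commute mult.left_commute)
  then have "s' * s = 2" using h by simp
  then have "s' dvd 2" by (metis dvd_triv_left)
  then have "s' \<le> 2" by (rule dvd_imp_le) simp
  then have s1: "s' = 1" using k(3) by (cases "s' = 0"; cases "s' = 2") auto
  have "even (b ^ y)" using k(4) by (metis dvd_triv_left)
  then have "even b" by simp
  moreover have "3 ^ k = 1 + 2 ^ k * b ^ (y2 - k * y)" using k(7) s1 by (simp add: numeral_3_eq_3)
  ultimately show False using three_power_excluded[OF k(2)] k by (metis gr_implies_not0 neq0_conv zero_less_diff)
qed

text \<open>One solution starts two shapes, the second with \<open>a\<close> and \<open>b\<close>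
  exchanged. If both are (iii), then \<open>s * s' = 1\<close>, so \<open>a ^ x = b ^ y\<close>, and
  \<open>2 ^ k - 1\<close>, \<open>2 ^ l - 1\<close> are powers of numbers with the same primes;
  hence \<open>k = l\<close>, and the terms of the other two solutions agree. If both are (iv), the
  odd numbers \<open>s\<close>, \<open>s'\<close> would have product 4.\<close>

lemma shapes_common_base:
  assumes A: "shape_iii a b c (x, y, z) (x1, y1, z1) \<or> shape_iv a b c (x, y, z) (x1, y1, z1)"
    and B: "shape_iii b a c (y, x, z) (y2, x2, z2) \<or> shape_iv b a c (y, x, z) (y2, x2, z2)"
    and ab: "a > 1" "b > 1" and xy: "x > 0" "y > 0"
  shows "{a ^ x1, b ^ y1} = {a ^ x2, b ^ y2}"
proof -
  consider "shape_iii a b c (x, y, z) (x1, y1, z1)" "shape_iii b a c (y, x, z) (y2, x2, z2)"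
    | "shape_iv a b c (x, y, z) (x1, y1, z1)" "shape_iv b a c (y, x, z) (y2, x2, z2)"
    using A B shapes_iii_iv_excluded ab by blast
  then show ?thesis
  proof cases
    case 1
    obtain k s where k: "k > 1" "y1 = k * y" "b ^ y = a ^ x * s" "k * x < x1"
       "(s + 1) ^ k = s ^ k + a ^ (x1 - k * x)"
      using 1(1) unfolding shape_iii_def by auto
    obtain l s' where l: "l > 1" "x2 = l * x" "a ^ x = b ^ y * s'" "l * y < y2"
       "(s' + 1) ^ l = s' ^ l + b ^ (y2 - l * y)"
      using 1(2) unfolding shape_iii_def by auto
    have "a ^ x * 1 = a ^ x * (s * s')" using k(3) l(3) by (metis mult.assoc mult_1_right)
    then have ss: "s = 1" "s' = 1" using ab by auto
    define v w where "v = x1 - k * x" and "w = y2 - l * y"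
    have vw: "v > 0" "w > 0" "x1 = k * x + v" "y2 = l * y + w" using k(4) l(4) by (auto simp: v_def w_def)
    have ka: "2 ^ k = 1 + a ^ v" and lb: "2 ^ l = 1 + b ^ w"
      using k(5) l(5) ss by (simp_all add: v_def w_def numeral_2_eq_2)
    have eq: "a ^ x = b ^ y" using k(3) ss by simp
    have pr: "q dvd a \<longleftrightarrow> q dvd b" if "prime q" for q
      using that eq xy by (metis prime_dvd_power_iff)
    have "l dvd k"
      using mersenne_prime_divisors[of k l] k(1) l(1) ka lb pr vw by (auto simp: prime_dvd_power_iff)
    moreover have "k dvd l"
      using mersenne_prime_divisors[of l k] k(1) l(1) ka lb pr vw by (auto simp: prime_dvd_power_iff)
    ultimately have kl: "k = l" by (simp add: dvd_antisym)
    then have "a ^ v = b ^ w" using ka lb by simp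
    then have "a ^ x1 = b ^ y2"
      using eq kl vw by (simp add: power_add mult.commute[of l] power_mult)
    moreover have "b ^ y1 = a ^ x2"
      using eq kl k(2) l(2) by (simp add: mult.commute[of l] power_mult)
    ultimately show ?thesis by auto
  next
    case 2
    obtain s h where k: "odd s" "2 * h = a ^ x" "b ^ y = h * s"
      using 2(1) unfolding shape_iv_def by auto
    obtain s' h' where l: "odd s'" "2 * h' = b ^ y" "a ^ x = h' * s'"
      using 2(2) unfolding shape_iv_def by auto
    have h: "h > 0" using k(2) ab by (metis gr0I mult_0_right not_one_less_zero power_eq_0_iff)
    have "h * 4 = 2 * (h' * s')" using k l by simp
    also have "\<dots> = h * (s * s')" using k l by (metis mult.assoc)
    finally have "s * s' = 4" using h by simp
    moreover have "odd (s * s')" using k l by simp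
    ultimately show ?thesis by simp
  qed
qed

text \<open>At \<open>p\<close> the third solution shares the equality of \<open>b\<close>- and
  \<open>c\<close>-valuations with the Type A solution, so these two form a shape. In shapes (iii)
  and (iv) the third solution turns out to be the first member, and all its valuations agree at an
  odd prime; it then forms a shape with the Type B solution as well, and two shapes with a common
  first member make the given solutions correspond.\<close>

lemma third_solution_excluded:
  fixes a b c :: nat
  assumes abc: "a > 1" "b > 1" "c > 1"
    and s1: "is_solution (a, b, c) (x1, y1, z1)" and s2: "is_solution (a, b, c) (x2, y2, z2)"
    and s3: "is_solution (a, b, c) (x3, y3, z3)"
    and tA: "\<And>p. prime p \<Longrightarrow> p dvd a \<Longrightarrow> p dvd b \<Longrightarrow> type_A_prime (a, b, c) p (x1, y1, z1)"
    and tB: "\<And>p. prime p \<Longrightarrow> p dvd a \<Longrightarrow> p dvd b \<Longrightarrow> type_B_prime (a, b, c) p (x2, y2, z2)"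
    and nc: "{a ^ x1, b ^ y1} \<noteq> {a ^ x2, b ^ y2}"
    and nf: "\<not> in_family family_i (a, b, c) (x1, y1, z1) (x2, y2, z2)"
    and ne: "(x3, y3, z3) \<noteq> (x1, y1, z1)" "(x3, y3, z3) \<noteq> (x2, y2, z2)"
    and p: "prime p" "p dvd a" "p dvd b" and p3: "multiplicity p b * y3 = multiplicity p c * z3"
  shows False
proof -
  have pc: "p dvd c" using common_prime_dvd_third p s1 by blast
  have gt: "multiplicity q n > 0" if "prime q" "q dvd n" "n > 1" for q n :: nat
    using that by (simp add: prime_multiplicity_gt_zero_iff)
  have p1: "multiplicity p b * y1 = multiplicity p c * z1" using tA[OF p] by simp
  have pr: "y1 * z3 = y3 * z1"
    by (rule proportional_of_equal_valuations[OF p1 p3 gt[OF p(1,3) abc(2)] gt[OF p(1) pc abc(3)]])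
  obtain S S' where S: "(S, S') = ((x1, y1, z1), (x3, y3, z3)) \<or> (S, S') = ((x3, y3, z3), (x1, y1, z1))"
    "shape_i a b c S S' \<or> shape_iii a b c S S' \<or> shape_iv a b c S S'"
    by (rule yz_proportional[OF abc p(1,3) pc s1 s3 ne(1)[symmetric] pr])
  have sols: "is_solution (a, b, c) S" "is_solution (a, b, c) S'" using S(1) s1 s3 by auto
  obtain x y z x' y' z' where SS: "S = (x, y, z)" "S' = (x', y', z')" by (metis surj_pair)
  have pos: "x > 0" "y > 0" "z > 0" using sols(1) SS by auto
  show False
  proof (cases "shape_i a b c S S'")
    case True
    obtain F e where e: "e > 0" "b ^ y = 2 ^ e * (2 ^ F - 1)" "a ^ x = 2 ^ (e + 1)"
      using True unfolding shape_i_def SS by auto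
    have "even (b ^ y)" "even (a ^ x)" using e by simp_all
    then have "type_B_prime (a, b, c) 2 (x2, y2, z2)" using tB[of 2] by simp
    then have "{a ^ x2, b ^ y2} = {a ^ x, b ^ y} \<or> {a ^ x2, b ^ y2} = {a ^ x', b ^ y'}"
      using shape_i_type_B[OF True[unfolded SS] abc pos s2] by blast
    \<comment> \<open>Since \<open>nc\<close> separates the two given solutions, the Type B solution
      must correspond to the third one and inherits its place in family (i).\<close>
    then have eq3: "{a ^ x2, b ^ y2} = {a ^ x3, b ^ y3}"
      using S(1) SS nc by auto
    obtain ABC S1 S2 where F: "(ABC, S1, S2) \<in> family_i"
      "corresponds ABC S1 (a, b, c) S" "corresponds ABC S2 (a, b, c) S'"
      using shape_i_family[OF True] by blast
    have tr: "corresponds ABC T (a, b, c) (x3, y3, z3) \<longleftrightarrow> corresponds ABC T (a, b, c) (x2, y2, z2)" for T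
      using eq3 by (cases ABC, cases T) auto
    have "(x1, y1, z1) \<noteq> (x2, y2, z2)" using nc by auto
    then have "in_family family_i (a, b, c) (x1, y1, z1) (x2, y2, z2)"
      unfolding in_family_def using F S(1) s1 s2 tr by blast
    then show False using nf by blast
  next
    case False
    then have sh: "shape_iii a b c (x, y, z) S' \<or> shape_iv a b c (x, y, z) S'" using S(2) SS by blast
    obtain q where q: "prime q" "odd q" "q dvd a" "q dvd b" "q dvd c"
      "multiplicity q a * x \<le> multiplicity q b * y"
      by (rule shape_iii_iv_base[OF sh abc pos])
    have qp: "multiplicity q a > 0" "multiplicity q b > 0" "multiplicity q c > 0"
      by (rule gt[OF q(1,3) abc(1)], rule gt[OF q(1,4) abc(2)], rule gt[OF q(1,5) abc(3)])
    \<comment> \<open>The first member of the shape is not Type A at \<open>q\<close>, whereas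
      \<open>(x1, y1, z1)\<close> is.\<close>
    have "S \<noteq> (x1, y1, z1)" using tA[OF q(1,3,4)] q(6) SS by auto
    then have S3: "(x, y, z) = (x3, y3, z3)" "S' = (x1, y1, z1)" using S(1) SS by auto
    have "multiplicity q b * y1 = multiplicity q c * z1" using tA[OF q(1,3,4)] by simp
    \<comment> \<open>The proportionality found at \<open>p\<close> mentions no prime and so
      transfers to \<open>q\<close>. With the inequality at \<open>q\<close>, all three valuations
      of the third solution agree there.\<close>
    then have "y1 * (multiplicity q b * y3) = y1 * (multiplicity q c * z3)"
      using pr by (metis mult.assoc mult.commute)
    then have "multiplicity q b * y3 = multiplicity q c * z3" using s1 by simp
    then have O: "multiplicity q a * x3 = multiplicity q c * z3"
      using solution_valuations[OF q(1) abc s3] q(6) S3 by auto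
    have q2: "multiplicity q a * x2 = multiplicity q c * z2" using tB[OF q(1,3,4)] by simp
    have pr': "x2 * z3 = x3 * z2"
      by (rule proportional_of_equal_valuations[OF q2 O qp(1,3)])
    have s2': "is_solution (b, a, c) (y2, x2, z2)" and s3': "is_solution (b, a, c) (y3, x3, z3)"
      using s2 s3 unfolding is_solution_swap .
    have ne': "(y2, x2, z2) \<noteq> (y3, x3, z3)" using ne(2) by auto
    obtain T T' where T: "(T, T') = ((y2, x2, z2), (y3, x3, z3)) \<or> (T, T') = ((y3, x3, z3), (y2, x2, z2))"
      "shape_i b a c T T' \<or> shape_iii b a c T T' \<or> shape_iv b a c T T'"
      by (rule yz_proportional[OF abc(2,1,3) q(1,3,5) s2' s3' ne' pr'])
    obtain u v w where TT: "T = (u, v, w)" by (metis surj_pair)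
    have posT: "u > 0" "v > 0" "w > 0" using T(1) TT s2 s3 by auto
    \<comment> \<open>Shape (i) would make \<open>b ^ u\<close> a power of 2, but the odd prime
      \<open>q\<close> divides \<open>b\<close>.\<close>
    have "\<not> shape_i b a c T T'"
    proof
      assume "shape_i b a c T T'"
      then obtain e where "b ^ u = 2 ^ (e + 1)" unfolding shape_i_def TT by auto
      moreover have "q dvd b ^ u" using q(1,4) posT(1) prime_dvd_power_iff by blast
      ultimately have "q dvd 2 ^ (e + 1)" by simp
      then have "q dvd 2" using q(1) prime_dvd_power by blast
      then show False using q(1,2) by (metis primes_dvd_imp_eq two_is_prime_nat even_numeral)
    qed
    then have shT: "shape_iii b a c (u, v, w) T' \<or> shape_iv b a c (u, v, w) T'" using T(2) TT by blast
    obtain r where r: "prime r" "odd r" "r dvd b" "r dvd a" "r dvd c"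
      "multiplicity r b * u \<le> multiplicity r a * v"
      by (rule shape_iii_iv_base[OF shT abc(2,1,3) posT])
    \<comment> \<open>Mirror image of the argument for \<open>S\<close>: after the exchange, the
      first member is not Type B at \<open>r\<close>.\<close>
    have "T \<noteq> (y2, x2, z2)" using tB[OF r(1,4,3)] r(6) TT by auto
    then have "(u, v, w) = (y3, x3, z3)" "T' = (y2, x2, z2)" using T(1) TT by auto
    then have "{a ^ x1, b ^ y1} = {a ^ x2, b ^ y2}"
      using shapes_common_base[of a b c x3 y3 z3 x1 y1 z1 y2 x2 z2] sh shT S3 abc s3 by auto
    then show False using nc by blast
  qed
qed

text \<open>The constant \<open>\<gamma>\<close> is the least positive third entry of a vector satisfying both relations, so every
  valuation vector is a multiple of one primitive vector.\<close>

lemma common_part_power: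
  fixes a b c y1 z1 x2 z2 :: nat
  assumes abc: "a > 0" "b > 0" "c > 0" and pos: "y1 > 0" "z1 > 0" "x2 > 0" "z2 > 0"
    and P: "finite P" "\<And>p. p \<in> P \<Longrightarrow> prime p" "\<And>p. p \<in> P \<Longrightarrow> p dvd a \<and> p dvd b \<and> p dvd c"
    and rel: "\<And>p. p \<in> P \<Longrightarrow> multiplicity p b * y1 = multiplicity p c * z1"
      "\<And>p. p \<in> P \<Longrightarrow> multiplicity p a * x2 = multiplicity p c * z2"
  obtains g \<alpha> \<beta> \<gamma> a1 b1 c1 where "g > 0" "\<alpha> > 0" "\<beta> > 0" "\<gamma> > 0" "a1 > 0" "b1 > 0" "c1 > 0"
    "a = g ^ \<alpha> * a1" "b = g ^ \<beta> * b1" "c = g ^ \<gamma> * c1"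
    "\<And>p. prime p \<Longrightarrow> p dvd g \<longleftrightarrow> p \<in> P"
    "\<And>p. p \<in> P \<Longrightarrow> \<not> p dvd a1 \<and> \<not> p dvd b1 \<and> \<not> p dvd c1"
proof -
  define u v where "u = y1 div gcd y1 z1" and "v = x2 div gcd x2 z2"
  define u' v' where "u' = z1 div gcd y1 z1" and "v' = z2 div gcd x2 z2"
  have u: "y1 = u * gcd y1 z1" "z1 = u' * gcd y1 z1" "coprime u u'"
    using pos by (auto simp: u_def u'_def div_gcd_coprime)
  have v: "x2 = v * gcd x2 z2" "z2 = v' * gcd x2 z2" "coprime v v'"
    using pos by (auto simp: v_def v'_def div_gcd_coprime)
  have pos': "u > 0" "u' > 0" "v > 0" "v' > 0"
    using u(1,2) v(1,2) pos by (metis gr0I mult_0)+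
  define \<gamma> where "\<gamma> = lcm u v"
  define \<beta> where "\<beta> = u' * (\<gamma> div u)"
  define \<alpha> where "\<alpha> = v' * (\<gamma> div v)"
  have uv: "u * (\<gamma> div u) = \<gamma>" "v * (\<gamma> div v) = \<gamma>" by (simp_all add: \<gamma>_def)
  have \<gamma>: "\<gamma> > 0" using pos' by (simp add: \<gamma>_def lcm_pos_nat)
  have \<alpha>\<beta>: "\<alpha> > 0" "\<beta> > 0"
    using pos' uv \<gamma> by (auto simp: \<alpha>_def \<beta>_def intro!: gr0I)
  define m where "m p = multiplicity p c div \<gamma>" for p
  have mult: "multiplicity p c = \<gamma> * m p \<and> multiplicity p b = \<beta> * m p \<and> multiplicity p a = \<alpha> * m p"
    if "p \<in> P" for p
  proof -
    have "multiplicity p b * u * gcd y1 z1 = multiplicity p c * u' * gcd y1 z1"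
      using rel(1)[OF that] u by (metis mult.assoc)
    then have bu: "multiplicity p b * u = multiplicity p c * u'" using pos by simp
    then have "u dvd multiplicity p c"
      using u(3) by (metis coprime_dvd_mult_left_iff dvd_triv_right)
    moreover have "multiplicity p a * v * gcd x2 z2 = multiplicity p c * v' * gcd x2 z2"
      using rel(2)[OF that] v by (metis mult.assoc)
    then have av: "multiplicity p a * v = multiplicity p c * v'" using pos by simp
    then have "v dvd multiplicity p c"
      using v(3) by (metis coprime_dvd_mult_left_iff dvd_triv_right)
    ultimately have "\<gamma> dvd multiplicity p c" by (simp add: \<gamma>_def lcm_least)
    then have c: "multiplicity p c = \<gamma> * m p" by (simp add: m_def)
    have "u * multiplicity p b = u * (\<beta> * m p)"
    proof -
      have "u * multiplicity p b = u' * (\<gamma> * m p)" using bu c by (simp add: mult.commute)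
      also have "\<dots> = u' * ((u * (\<gamma> div u)) * m p)" by (simp only: uv)
      also have "\<dots> = u * (\<beta> * m p)" by (simp add: \<beta>_def mult.assoc mult.left_commute)
      finally show ?thesis .
    qed
    moreover have "v * multiplicity p a = v * (\<alpha> * m p)"
    proof -
      have "v * multiplicity p a = v' * (\<gamma> * m p)" using av c by (simp add: mult.commute)
      also have "\<dots> = v' * ((v * (\<gamma> div v)) * m p)" by (simp only: uv)
      also have "\<dots> = v * (\<alpha> * m p)" by (simp add: \<alpha>_def mult.assoc mult.left_commute)
      finally show ?thesis .
    qed
    ultimately show ?thesis using c pos' by simp
  qed
  have m0: "m p > 0" if "p \<in> P" for p
  proof -
    have "multiplicity p c > 0" using P(2,3)[OF that] abc by (simp add: prime_multiplicity_gt_zero_iff)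
    then show ?thesis using mult[OF that] by (auto intro: gr0I)
  qed
  define g where "g = (\<Prod>p\<in>P. p ^ m p)"
  have g0: "g > 0" unfolding g_def by (rule prod_pos) (use P(2) prime_gt_0_nat in auto)
  have mg: "multiplicity p g = (if p \<in> P then m p else 0)" if "prime p" for p
    unfolding g_def by (rule multiplicity_prod_prime_powers) (use P that in auto)
  \<comment> \<open>Used for \<open>a\<close>, \<open>b\<close>, \<open>c\<close> in turn:
    \<open>g ^ \<delta>\<close> collects exactly the part of \<open>n\<close> built from the primes
    in \<open>P\<close>.\<close>
  have part: "\<exists>n1. n1 > 0 \<and> n = g ^ \<delta> * n1 \<and> (\<forall>p\<in>P. \<not> p dvd n1)"
    if n: "n > 0" "\<And>p. p \<in> P \<Longrightarrow> multiplicity p n = \<delta> * m p" for n \<delta>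
  proof -
    have mgd: "multiplicity p (g ^ \<delta>) = (if p \<in> P then \<delta> * m p else 0)" if "prime p" for p
      using mg[OF that] g0 that by (simp add: prime_elem_multiplicity_power_distrib)
    have "g ^ \<delta> dvd n"
      by (rule multiplicity_le_imp_dvd) (use g0 n mgd in auto)
    then obtain n1 where n1: "n = g ^ \<delta> * n1" by blast
    have n10: "n1 > 0" using n n1 by (auto intro: gr0I)
    have "\<not> p dvd n1" if "p \<in> P" for p
    proof -
      have "multiplicity p n = multiplicity p (g ^ \<delta>) + multiplicity p n1"
        unfolding n1 using P(2)[OF that] g0 n10 by (intro prime_elem_multiplicity_mult_distrib) auto
      then have "multiplicity p n1 = 0" using mgd[OF P(2)[OF that]] n(2)[OF that] that by simp
      then show ?thesis
        using P(2)[OF that] n10 by (metis neq0_conv prime_multiplicity_gt_zero_iff prime_imp_prime_elem)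
    qed
    then show ?thesis using n1 n10 by blast
  qed
  obtain a1 where a1: "a1 > 0" "a = g ^ \<alpha> * a1" "\<forall>p\<in>P. \<not> p dvd a1" using part[of a \<alpha>] mult abc by blast
  obtain b1 where b1: "b1 > 0" "b = g ^ \<beta> * b1" "\<forall>p\<in>P. \<not> p dvd b1" using part[of b \<beta>] mult abc by blast
  obtain c1 where c1: "c1 > 0" "c = g ^ \<gamma> * c1" "\<forall>p\<in>P. \<not> p dvd c1" using part[of c \<gamma>] mult abc by blast
  have gP: "p dvd g \<longleftrightarrow> p \<in> P" if "prime p" for p
  proof -
    have "p dvd g \<longleftrightarrow> multiplicity p g > 0"
      using prime_multiplicity_gt_zero_iff[of p g] that g0 by simp
    then show ?thesis using mg[OF that] m0 by simp
  qed
  show ?thesis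
    by (rule that[OF g0 \<alpha>\<beta> \<gamma> a1(1) b1(1) c1(1) a1(2) b1(2) c1(2) gP]) (use a1(3) b1(3) c1(3) in auto)
qed

section \<open>The two types across all common primes\<close>

text \<open>Type A says z1 / x1 < \<alpha> / \<gamma> and Type B says z2 / x2 = \<alpha> / \<gamma>;
  the quotient depending on the prime drops out.\<close>

lemma type_A_B_order:
  assumes A: "type_A_prime (a, b, c) p (x1, y1, z1)" and B: "type_B_prime (a, b, c) p (x2, y2, z2)"
    and abc: "a > 1" "c > 1" and z2: "z2 > 0"
  shows "x2 * z1 < x1 * z2"
proof -
  define \<alpha> \<gamma> where d: "\<alpha> = multiplicity p a" "\<gamma> = multiplicity p c"
  have pos: "\<alpha> > 0" "\<gamma> > 0" using A abc by (simp_all add: d prime_multiplicity_gt_zero_iff)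
  have v: "\<gamma> * z1 < \<alpha> * x1" "\<alpha> * x2 = \<gamma> * z2" using A B by (auto simp: d)
  have "(\<alpha> * \<gamma>) * (x2 * z1) = (\<alpha> * x2) * (\<gamma> * z1)" by simp
  also have "\<dots> < (\<gamma> * z2) * (\<alpha> * x1)" using v pos z2 by simp
  also have "\<dots> = (\<alpha> * \<gamma>) * (x1 * z2)" by simp
  finally show ?thesis by simp
qed

lemma two_solutions_of_types_A_B:
  fixes a b c :: nat
  assumes abc: "a > 1" "b > 1" "c > 1" and gcd: "gcd a b > 1"
    and s1: "is_solution (a, b, c) (x1, y1, z1)" and s2: "is_solution (a, b, c) (x2, y2, z2)"
    and types: "\<forall>p. prime p \<and> p dvd a \<and> p dvd b \<longrightarrow>
      type_A_prime (a, b, c) p (x1, y1, z1) \<and> type_B_prime (a, b, c) p (x2, y2, z2)"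
    and nc: "{a ^ x1, b ^ y1} \<noteq> {a ^ x2, b ^ y2}"
    and nf: "\<not> in_family family_i (a, b, c) (x1, y1, z1) (x2, y2, z2)"
      "\<not> in_family family_i (a, b, c) (x2, y2, z2) (x1, y1, z1)"
  shows "\<exists>g \<alpha> \<beta> \<gamma> a1 b1 c1 :: nat.
            g > 0 \<and> \<alpha> > 0 \<and> \<beta> > 0 \<and> \<gamma> > 0 \<and> a1 > 0 \<and> b1 > 0 \<and> c1 > 0 \<and>
            a = g ^ \<alpha> * a1 \<and> b = g ^ \<beta> * b1 \<and> c = g ^ \<gamma> * c1 \<and>
            gcd g (a1 * b1 * c1) = 1 \<and> gcd a1 b1 = 1 \<and>
            type_A (a, b, c) g (x1, y1, z1) \<and> type_B (a, b, c) g (x2, y2, z2)"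
    and "is_solution (a, b, c) (x, y, z) \<Longrightarrow> (x, y, z) = (x1, y1, z1) \<or> (x, y, z) = (x2, y2, z2)"
proof -
  have tA: "type_A_prime (a, b, c) p (x1, y1, z1)" and tB: "type_B_prime (a, b, c) p (x2, y2, z2)"
    if "prime p" "p dvd a" "p dvd b" for p
    using types that by blast+
  obtain p where p: "prime p" "p dvd a" "p dvd b"
    using prime_factor_nat[of "gcd a b"] gcd by auto
  \<comment> \<open>Removing all common primes of \<open>a\<close> and \<open>b\<close>, not just
    one, is what makes \<open>a1\<close> and \<open>b1\<close> coprime.\<close>
  define P where "P = {q. prime q \<and> q dvd a \<and> q dvd b}"
  have finP: "finite P"
    by (rule finite_subset[of _ "{d. d dvd a}"]) (use abc in \<open>auto simp: P_def intro!: finite_divisors_nat\<close>)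
  have Pc: "q dvd c" if "q \<in> P" for q using that common_prime_dvd_third s1 P_def by blast
  show "\<exists>g \<alpha> \<beta> \<gamma> a1 b1 c1 :: nat.
            g > 0 \<and> \<alpha> > 0 \<and> \<beta> > 0 \<and> \<gamma> > 0 \<and> a1 > 0 \<and> b1 > 0 \<and> c1 > 0 \<and>
            a = g ^ \<alpha> * a1 \<and> b = g ^ \<beta> * b1 \<and> c = g ^ \<gamma> * c1 \<and>
            gcd g (a1 * b1 * c1) = 1 \<and> gcd a1 b1 = 1 \<and>
            type_A (a, b, c) g (x1, y1, z1) \<and> type_B (a, b, c) g (x2, y2, z2)"
  proof (rule common_part_power[of a b c y1 z1 x2 z2 P])
    fix g \<alpha> \<beta> \<gamma> a1 b1 c1 :: nat
    assume *: "g > 0" "\<alpha> > 0" "\<beta> > 0" "\<gamma> > 0" "a1 > 0" "b1 > 0" "c1 > 0"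
      "a = g ^ \<alpha> * a1" "b = g ^ \<beta> * b1" "c = g ^ \<gamma> * c1"
      and g: "\<And>p. prime p \<Longrightarrow> p dvd g \<longleftrightarrow> p \<in> P"
      and nd: "\<And>p. p \<in> P \<Longrightarrow> \<not> p dvd a1 \<and> \<not> p dvd b1 \<and> \<not> p dvd c1"
    have "coprime g (a1 * b1 * c1)"
    proof (rule ccontr)
      assume "\<not> coprime g (a1 * b1 * c1)"
      then have "gcd g (a1 * b1 * c1) \<noteq> 1" unfolding coprime_iff_gcd_eq_1 .
      then obtain q where q: "prime q" "q dvd gcd g (a1 * b1 * c1)" using prime_factor_nat by blast
      then have "q dvd g" by simp
      then have "q \<in> P" using g[OF q(1)] by blast
      then show False using nd q by (simp add: prime_dvd_mult_iff)
    qed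
    moreover have "coprime a1 b1"
    proof (rule ccontr)
      assume "\<not> coprime a1 b1"
      then have "gcd a1 b1 \<noteq> 1" unfolding coprime_iff_gcd_eq_1 .
      then obtain q where q: "prime q" "q dvd gcd a1 b1" using prime_factor_nat by blast
      then have "q \<in> P" using *(8,9) by (simp add: P_def)
      then show False using nd q by simp
    qed
    moreover have "p dvd g" using g p P_def by blast
    then have "g > 1" using prime_gt_1_nat[OF p(1)] *(1) dvd_imp_le by (meson less_le_trans)
    then have "type_A (a, b, c) g (x1, y1, z1)" "type_B (a, b, c) g (x2, y2, z2)"
      unfolding type_A_def type_B_def using g tA tB P_def by blast+
    ultimately show ?thesis
      using * unfolding coprime_iff_gcd_eq_1
      by - (rule exI[of _ g], rule exI[of _ \<alpha>], rule exI[of _ \<beta>], rule exI[of _ \<gamma>],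
        rule exI[of _ a1], rule exI[of _ b1], rule exI[of _ c1], intro conjI; assumption)
  qed (use abc s1 s2 finP Pc tA tB in \<open>auto simp: P_def\<close>)
  show "(x, y, z) = (x1, y1, z1) \<or> (x, y, z) = (x2, y2, z2)" if s3: "is_solution (a, b, c) (x, y, z)"
  proof (rule ccontr)
    assume "\<not> ?thesis"
    then have ne: "(x, y, z) \<noteq> (x1, y1, z1)" "(x, y, z) \<noteq> (x2, y2, z2)" by auto
    \<comment> \<open>Equality of all three valuations is absorbed by the first two cases; the
      strict third case falls to the size comparison with the Type A solution.\<close>
    consider "multiplicity p b * y = multiplicity p c * z" | "multiplicity p a * x = multiplicity p c * z"
      | "multiplicity p a * x = multiplicity p b * y" "multiplicity p b * y < multiplicity p c * z"
      using solution_valuations[OF p(1) abc s3] by linarith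
    then show False
    proof cases
      case 1
      show ?thesis
        by (rule third_solution_excluded[OF abc s1 s2 s3 tA tB nc nf(1) ne p 1])
    next
      case 2
      \<comment> \<open>Exchanging \<open>a\<close> and \<open>b\<close> also exchanges the types,
        so the two given solutions trade places.\<close>
      have sw: "is_solution (b, a, c) (y2, x2, z2)" "is_solution (b, a, c) (y1, x1, z1)"
          "is_solution (b, a, c) (y, x, z)"
        using s1 s2 s3 unfolding is_solution_swap by auto
      have tA': "type_A_prime (b, a, c) q (y2, x2, z2)" and tB': "type_B_prime (b, a, c) q (y1, x1, z1)"
        if "prime q" "q dvd b" "q dvd a" for q
        using tA[OF that(1,3,2)] tB[OF that(1,3,2)] by simp_all
      have nc': "{b ^ y2, a ^ x2} \<noteq> {b ^ y1, a ^ x1}" using nc by (metis insert_commute)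
      have nf': "\<not> in_family family_i (b, a, c) (y2, x2, z2) (y1, x1, z1)"
        unfolding in_family_swap by (rule nf(2))
      have ne': "(y, x, z) \<noteq> (y2, x2, z2)" "(y, x, z) \<noteq> (y1, x1, z1)" using ne by auto
      show ?thesis
        by (rule third_solution_excluded[OF abc(2,1,3) sw tA' tB' nc' nf' ne' p(1,3,2) 2])
    next
      case 3
      have "multiplicity p a > 0" "multiplicity p b > 0"
        using p abc by (simp_all add: prime_multiplicity_gt_zero_iff)
      moreover have "p dvd c" using common_prime_dvd_third p s1 by blast
      ultimately show ?thesis
        using type_C_excluded[OF p(1) _ abc, of x1 y1 z1 x y z] s1 s3 tA[OF p] 3 by auto
    qed
  qed
qed

theorem theorem4p5:
  fixes a b c x1 y1 z1 x2 y2 z2 :: nat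
  assumes "a > 1" and "b > 1" and "c > 1"
    and "gcd a b > 1"
    and "\<not> (\<exists>i j k :: nat. a = 2 ^ i \<and> b = 2 ^ j \<and> c = 2 ^ k)"
    and "is_solution (a, b, c) (x1, y1, z1)"
    and "is_solution (a, b, c) (x2, y2, z2)"
    and "\<not> corresponds (a, b, c) (x1, y1, z1) (a, b, c) (x2, y2, z2)"
    and "\<not> in_family family_i (a, b, c) (x1, y1, z1) (x2, y2, z2)"
    and "\<not> in_family family_ii (a, b, c) (x1, y1, z1) (x2, y2, z2)"
    and "\<not> in_family family_iii (a, b, c) (x1, y1, z1) (x2, y2, z2)"
    and "\<not> in_family family_iv (a, b, c) (x1, y1, z1) (x2, y2, z2)"
  shows "(\<exists>g \<alpha> \<beta> \<gamma> a1 b1 c1 :: nat.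
            g > 0 \<and> \<alpha> > 0 \<and> \<beta> > 0 \<and> \<gamma> > 0 \<and> a1 > 0 \<and> b1 > 0 \<and> c1 > 0 \<and>
            a = g ^ \<alpha> * a1 \<and> b = g ^ \<beta> * b1 \<and> c = g ^ \<gamma> * c1 \<and>
            gcd g (a1 * b1 * c1) = 1 \<and> gcd a1 b1 = 1 \<and>
            ((type_A (a, b, c) g (x1, y1, z1) \<and> type_B (a, b, c) g (x2, y2, z2)) \<or>
             (type_B (a, b, c) g (x1, y1, z1) \<and> type_A (a, b, c) g (x2, y2, z2)))) \<and>
         (\<forall>x y z. is_solution (a, b, c) (x, y, z) \<longrightarrow>
            (x, y, z) = (x1, y1, z1) \<or> (x, y, z) = (x2, y2, z2))"
proof -
  note abc = assms(1-3) and s1 = assms(6) and s2 = assms(7)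
  have ne: "(x1, y1, z1) \<noteq> (x2, y2, z2)" using assms(8) by auto
  have nc: "{a ^ x1, b ^ y1} \<noteq> {a ^ x2, b ^ y2}" using assms(8) by simp
  obtain p where p: "prime p" "p dvd a" "p dvd b"
    using prime_factor_nat[of "gcd a b"] assms(4) by auto
  have pc: "p dvd c" using common_prime_dvd_third p s1 by blast
  have sw: "is_solution (b, a, c) (y1, x1, z1)" "is_solution (b, a, c) (y2, x2, z2)"
    using s1 s2 unfolding is_solution_swap by auto
  have xy: "x1 * y2 \<noteq> x2 * y1"
    using xy_proportional[OF abc p s1 s2 ne _ assms(5)] assms(10) by blast
  have yz: "y1 * z2 \<noteq> y2 * z1"
    using yz_proportional_family[OF abc p(1,3) pc s1 s2 ne] assms(9,11,12) by blast
  have ne': "(y1, x1, z1) \<noteq> (y2, x2, z2)" using ne by auto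
  have xz: "x1 * z2 \<noteq> x2 * z1"
    using yz_proportional_family[OF abc(2,1,3) p(1,2) pc sw ne', unfolded in_family_swap]
      assms(9,11,12) by blast
  have sym: "\<not> in_family family_i (a, b, c) (x2, y2, z2) (x1, y1, z1)"
    using assms(9) unfolding in_family_def by metis
  have z: "z1 > 0" "z2 > 0" using s1 s2 by auto
  have types: "type_A_prime (a, b, c) q (x1, y1, z1) \<and> type_B_prime (a, b, c) q (x2, y2, z2) \<or>
      type_B_prime (a, b, c) q (x1, y1, z1) \<and> type_A_prime (a, b, c) q (x2, y2, z2)"
    if "prime q" "q dvd a" "q dvd b" for q
    by (rule not_proportional_types[OF abc that s1 s2 xy yz xz])
  show ?thesis
  \<comment> \<open>The condition mentions no prime, so it fixes the same assignment of types at
    every common prime.\<close>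
  proof (cases "x2 * z1 < x1 * z2")
    case True
    have t: "\<forall>q. prime q \<and> q dvd a \<and> q dvd b \<longrightarrow>
        type_A_prime (a, b, c) q (x1, y1, z1) \<and> type_B_prime (a, b, c) q (x2, y2, z2)"
    proof (intro allI impI)
      fix q assume "prime q \<and> q dvd a \<and> q dvd b"
      then show "type_A_prime (a, b, c) q (x1, y1, z1) \<and> type_B_prime (a, b, c) q (x2, y2, z2)"
        using types[of q] type_A_B_order[of a b c q x2 y2 z2 x1 y1 z1] abc z True by auto
    qed
    note res = two_solutions_of_types_A_B[OF abc assms(4) s1 s2 t nc assms(9) sym]
    show ?thesis
    proof (intro conjI allI impI)
      show "\<exists>g \<alpha> \<beta> \<gamma> a1 b1 c1 :: nat.
            g > 0 \<and> \<alpha> > 0 \<and> \<beta> > 0 \<and> \<gamma> > 0 \<and> a1 > 0 \<and> b1 > 0 \<and> c1 > 0 \<and>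
            a = g ^ \<alpha> * a1 \<and> b = g ^ \<beta> * b1 \<and> c = g ^ \<gamma> * c1 \<and>
            gcd g (a1 * b1 * c1) = 1 \<and> gcd a1 b1 = 1 \<and>
            ((type_A (a, b, c) g (x1, y1, z1) \<and> type_B (a, b, c) g (x2, y2, z2)) \<or>
             (type_B (a, b, c) g (x1, y1, z1) \<and> type_A (a, b, c) g (x2, y2, z2)))"
        using res(1)
        by - ((erule ex_forward)+, elim conjE, intro conjI disjI1; assumption)
    qed (use res(2) in blast)
  next
    case False
    have t: "\<forall>q. prime q \<and> q dvd a \<and> q dvd b \<longrightarrow>
        type_A_prime (a, b, c) q (x2, y2, z2) \<and> type_B_prime (a, b, c) q (x1, y1, z1)"
    proof (intro allI impI)
      fix q assume "prime q \<and> q dvd a \<and> q dvd b"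
      then show "type_A_prime (a, b, c) q (x2, y2, z2) \<and> type_B_prime (a, b, c) q (x1, y1, z1)"
        using types[of q] type_A_B_order[of a b c q x1 y1 z1 x2 y2 z2] abc z False by auto
    qed
    note res = two_solutions_of_types_A_B[OF abc assms(4) s2 s1 t nc[symmetric] sym assms(9)]
    show ?thesis
    proof (intro conjI allI impI)
      show "\<exists>g \<alpha> \<beta> \<gamma> a1 b1 c1 :: nat.
            g > 0 \<and> \<alpha> > 0 \<and> \<beta> > 0 \<and> \<gamma> > 0 \<and> a1 > 0 \<and> b1 > 0 \<and> c1 > 0 \<and>
            a = g ^ \<alpha> * a1 \<and> b = g ^ \<beta> * b1 \<and> c = g ^ \<gamma> * c1 \<and>
            gcd g (a1 * b1 * c1) = 1 \<and> gcd a1 b1 = 1 \<and>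
            ((type_A (a, b, c) g (x1, y1, z1) \<and> type_B (a, b, c) g (x2, y2, z2)) \<or>
             (type_B (a, b, c) g (x1, y1, z1) \<and> type_A (a, b, c) g (x2, y2, z2)))"
        using res(1)
        by - ((erule ex_forward)+, elim conjE, intro conjI disjI2; assumption)
    qed (use res(2) in blast)
  qed
qed

end
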